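(* Let $s\ge 2$ be an integer. Let $A\subseteq \mathbb{N}=\{1,2,3,\dots\}$ be a random set in which the events $\{n\in A\}$, $n\ge 1$, are mutually independent with $P(n\in A)=\frac1s n^{-1+1/s}$. Let $sA=\{a_1+\cdots+a_s: a_1,\dots,a_s\in A\}$ and let $b_1<b_2<\cdots$ be the elements of $sA$ in increasing order. Then almost surely $$\limsup_{n\to\infty}\frac{b_{n+1}-b_n}{\log b_n}=\frac{s^s\, s!}{\Gamma^s(1/s)}.$$
   Context: $\Gamma$ denotes Euler's Gamma function. *)

theory Defs
  imports "HOL-Probability.Probability" "HOL-Library.Infinite_Set"
begin

definition sumset :: "nat \<Rightarrow> nat set \<Rightarrow> nat set" where
  "sumset s A = {sum_list xs | xs. length xs = s \<and> set xs \<subseteq> A}"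

end

theory Submission
  imports Defs "HOL-Real_Asymp.Real_Asymp"
begin

text \<open>The expected number of representations of \<open>n\<close> as a sum of \<open>s\<close> distinct elements of \<open>A\<close> tends
  to \<open>\<lambda> = \<Gamma>(1/s)\<^sup>s / (s\<^sup>s s!)\<close>; this is read off from \<open>(1 - X)\<^bsup>-a\<^esup> (1 - X)\<^bsup>-b\<^esup> = (1 - X)\<^bsup>-(a+b)\<^esup>\<close>, as
  the coefficients of \<open>(1 - X)\<^bsup>-a\<^esup>\<close> are asymptotic to \<open>n\<^bsup>a-1\<^esup> / \<Gamma>(a)\<close>. For a set \<open>I\<close> of \<open>O(log N)\<close> integers of
  size at least \<open>N\<close>, the probability that \<open>sA\<close> misses \<open>I\<close> is bounded below by Harris' inequality and above by
  Janson's inequality, and up to a factor tending to \<open>1\<close> both bounds are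
  \<open>exp (- \<Sum>n\<in>I. \<mu>(n))\<close>, where \<open>\<mu>(n) \<longlongrightarrow> \<lambda>\<close> is that expected number.

  If \<open>\<kappa> > 1/\<lambda>\<close>, the probabilities that \<open>(N, N + \<kappa> log N]\<close> is missed are summable, so Borel and Cantelli give the
  upper bound. If \<open>\<kappa> < 1/\<lambda>\<close>, cut \<open>[N, 2N]\<close> into intervals of length about \<open>\<kappa> log (2N)\<close>. The two bounds show
  that the events that these are missed are asymptotically pairwise independent, while their expected number
  tends to infinity, so by Chebyshev's inequality some interval is missed with probability tending to \<open>1\<close>.\<close>

text \<open>The events that different n lie in sA are dependent, and the second moment argument
  compares the probability that two intervals are both missed with the product of the single
  probabilities. The quotient must tend to 1, so the Harris and Janson bounds have to agree up to a
  factor 1 + o(1), while the exponents themselves are of order log N. Both bounds carry the same sum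
  of mu(n), which cancels in the quotient; hence the mere convergence of mu(n) suffices, although
  only the remaining errors are controlled by a rate. That rate is N^(-1/(2s)), which beats the
  factor (log N)^2 coming from pairs of integers. A coincidence of summands gains about n^(-1/s),
  and half of this exponent is given up to keep the convolutions in the overlap estimate away from
  the critical exponent -1.

  A second obstacle is that sA allows repeated summands whereas lambda counts distinct ones. The
  upper bound may forget representations with repetitions, but the lower bound has to avoid them
  too, so their total weight must be shown to vanish.\<close>

unbundle no vec_syntax
unbundle fps_syntax

section \<open>Convolution of sequences of regular growth\<close>

text \<open>The series (1 - X)^(-a), given by its coefficients. It is the yardstick for sequences of
  order n^(a-1), because products of such series are again exactly of this form.\<close>

definition rising :: "real \<Rightarrow> real fps" where
  "rising a = Abs_fps (\<lambda>n. pochhammer a n / fact n)"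

lemma rising_nth: "rising a $ n = pochhammer a n / fact n"
  by (simp add: rising_def)

lemma rising_pos: "a > 0 \<Longrightarrow> rising a $ n > 0"
  by (simp add: rising_nth pochhammer_pos)

lemma rising_1 [simp]: "rising 1 $ n = 1"
  by (simp add: rising_nth pochhammer_fact[symmetric])

text \<open>Up to sign the coefficients are the binomials \<open>-a gchoose k\<close>, so this is
  Vandermonde's identity. It takes the place of a comparison of convolution sums with a Beta
  integral.\<close>

lemma rising_mult: "rising a * rising b = rising (a + b)"
proof (rule fps_ext)
  fix n
  have *: "rising c $ k = (-1) ^ k * ((-c) gchoose k)" for c k
    by (simp add: rising_nth gbinomial_pochhammer)
  have "(rising a * rising b) $ n = (\<Sum>i=0..n. (-1) ^ n * (((-a) gchoose i) * ((-b) gchoose (n - i))))"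
    unfolding fps_mult_nth *
  proof (rule sum.cong[OF refl])
    fix i assume "i \<in> {0..n}"
    then have "(-1 :: real) ^ n = (-1) ^ i * (-1) ^ (n - i)" by (simp flip: power_add)
    then show "(-1) ^ i * (- a gchoose i) * ((-1) ^ (n - i) * (- b gchoose (n - i)))
        = (-1) ^ n * ((- a gchoose i) * (- b gchoose (n - i)))" by simp
  qed
  also have "\<dots> = rising (a + b) $ n"
    by (simp add: * sum_distrib_left[symmetric] gbinomial_Vandermonde)
  finally show "(rising a * rising b) $ n = rising (a + b) $ n" .
qed

lemma rising_asymp:
  assumes "a > 0"
  shows "(\<lambda>n. rising a $ n / real n powr (a - 1)) \<longlonglongrightarrow> 1 / Gamma a"
proof -
  \<comment> \<open>\<open>rGamma_series\<close> contains \<open>pochhammer a (Suc n)\<close> over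
    n^a. The factor n / (a + n) removes the last term a + n of the product and lowers the exponent
    to a - 1.\<close>
  have "(\<lambda>n. rGamma_series a n * (real n / (a + real n))) \<longlonglongrightarrow> rGamma a * 1"
    by (intro tendsto_mult rGamma_series_LIMSEQ) real_asymp
  moreover have "\<forall>\<^sub>F n in sequentially. rGamma_series a n * (real n / (a + real n)) = rising a $ n / real n powr (a - 1)"
    using eventually_gt_at_top[of 0]
  proof eventually_elim
    case (elim n)
    then have "a + real n \<noteq> 0" "real n \<noteq> 0" using assms by auto
    moreover have "real n powr (a - 1) = exp (a * ln (real n)) / real n"
      using elim by (simp add: powr_def left_diff_distrib exp_diff)
    ultimately show ?case
      by (simp add: rGamma_series_def pochhammer_Suc rising_nth)
  qed
  ultimately show ?thesis
    by (simp add: Lim_transform_eventually rGamma_inverse_Gamma divide_inverse)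
qed

lemma convergent_ratio_bound:
  fixes f g :: "nat \<Rightarrow> real"
  assumes "(\<lambda>n. f n / g n) \<longlonglongrightarrow> l" "\<And>n. n \<ge> 1 \<Longrightarrow> g n > 0"
  shows "\<exists>C>0. \<forall>n\<ge>1. \<bar>f n\<bar> \<le> C * g n"
proof -
  have "Bseq (\<lambda>n. f n / g n)" using assms(1) by (rule convergent_imp_Bseq[OF convergentI])
  then obtain C where C: "C > 0" "\<And>n. \<bar>f n / g n\<bar> \<le> C" by (auto simp: Bseq_def)
  have "\<bar>f n\<bar> \<le> C * g n" if "n \<ge> 1" for n
    using C(2)[of n] assms(2)[OF that] by (simp add: abs_divide pos_divide_le_eq)
  then show ?thesis using C(1) by blast
qed

lemma rising_le_powr:
  assumes "a > 0"
  obtains C where "C > 0" "\<And>n. n \<ge> 1 \<Longrightarrow> rising a $ n \<le> C * real n powr (a - 1)"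
proof -
  have "real n powr (a - 1) > 0" if "n \<ge> 1" for n using that by simp
  from convergent_ratio_bound[OF rising_asymp[OF assms] this]
  obtain C where "C > 0" "\<And>n. n \<ge> 1 \<Longrightarrow> \<bar>rising a $ n\<bar> \<le> C * real n powr (a - 1)" by blast
  then show ?thesis using that rising_pos[OF assms] by (metis abs_of_pos)
qed

lemma powr_le_rising:
  assumes "a > 0"
  obtains C where "C > 0" "\<And>n. n \<ge> 1 \<Longrightarrow> real n powr (a - 1) \<le> C * rising a $ n"
proof -
  have "(\<lambda>n. inverse (rising a $ n / real n powr (a - 1))) \<longlonglongrightarrow> inverse (1 / Gamma a)"
    using Gamma_real_pos[OF assms] by (intro tendsto_inverse rising_asymp assms) auto
  then have "(\<lambda>n. real n powr (a - 1) / rising a $ n) \<longlonglongrightarrow> Gamma a" by simp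
  from convergent_ratio_bound[OF this] rising_pos[OF assms]
  obtain C where "C > 0" "\<And>n. n \<ge> 1 \<Longrightarrow> \<bar>real n powr (a - 1)\<bar> \<le> C * rising a $ n" by blast
  then show ?thesis using that by simp
qed

text \<open>The quotient is of order n^(-a). This disposes of each of the finitely many initial
  terms of a convolution.\<close>

lemma rising_shift_negligible:
  assumes "a > 0" "b > 0"
  shows "(\<lambda>n. rising b $ (n - k) / rising (a + b) $ n) \<longlonglongrightarrow> 0"
proof -
  obtain C where C: "C > 0" "\<And>n. n \<ge> 1 \<Longrightarrow> rising b $ n \<le> C * real n powr (b - 1)"
    using rising_le_powr[OF assms(2)] by blast
  obtain D where D: "D > 0" "\<And>n. n \<ge> 1 \<Longrightarrow> real n powr (a + b - 1) \<le> D * rising (a + b) $ n"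
    using powr_le_rising[of "a + b"] assms by auto
  have "(\<lambda>n. C * D * ((real n - real k) powr (b - 1) / real n powr (a + b - 1))) \<longlonglongrightarrow> C * D * 0"
    using assms by (intro tendsto_mult tendsto_const) real_asymp
  then have lim: "(\<lambda>n. C * D * ((real n - real k) powr (b - 1) / real n powr (a + b - 1))) \<longlonglongrightarrow> 0" by simp
  show ?thesis
  proof (rule tendsto_sandwich[OF _ _ tendsto_const lim])
    show "\<forall>\<^sub>F n in sequentially. 0 \<le> rising b $ (n - k) / rising (a + b) $ n"
      using rising_pos[of b] rising_pos[of "a + b"] assms by (intro always_eventually) (simp add: less_imp_le)
    show "\<forall>\<^sub>F n in sequentially. rising b $ (n - k) / rising (a + b) $ n
        \<le> C * D * ((real n - real k) powr (b - 1) / real n powr (a + b - 1))"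
      using eventually_gt_at_top[of k]
    proof eventually_elim
      case (elim n)
      have p: "real n powr (a + b - 1) > 0" "rising (a + b) $ n > 0"
        using elim rising_pos[of "a + b"] assms by auto
      have "rising b $ (n - k) / rising (a + b) $ n \<le> C * real (n - k) powr (b - 1) / (real n powr (a + b - 1) / D)"
        using elim C(1) C(2)[of "n - k"] D(1) D(2)[of n] p
        by (intro frac_le) (auto simp: field_simps)
      then show ?case using elim by (simp add: of_nat_diff mult_ac)
    qed
  qed
qed

text \<open>From some index \<open>N0\<close> on, h is at most e times \<open>rising a\<close>, and
  by \<open>rising_mult\<close> that part of the convolution is at most e * C times
  \<open>rising (a + b)\<close>. The finitely many terms before \<open>N0\<close> are negligible by
  \<open>rising_shift_negligible\<close>.\<close>

lemma fps_mult_negligible: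
  fixes h g :: "real fps"
  assumes ab: "a > 0" "b > 0"
    and h: "(\<lambda>n. h $ n / rising a $ n) \<longlonglongrightarrow> 0"
    and g: "\<And>n. \<bar>g $ n\<bar> \<le> C * rising b $ n"
  shows "(\<lambda>n. (h * g) $ n / rising (a + b) $ n) \<longlonglongrightarrow> 0"
proof (rule LIMSEQ_I)
  fix r :: real assume r: "r > 0"
  have C0: "C \<ge> 0"
  proof -
    have "0 \<le> C * rising b $ 0" using g[of 0] by linarith
    then show ?thesis using rising_pos[of b 0] ab by (simp add: zero_le_mult_iff)
  qed
  have pa: "rising a $ n > 0" and pb: "rising b $ n > 0" and pab: "rising (a + b) $ n > 0" for n
    using ab by (auto intro!: rising_pos)
  \<comment> \<open>C may be 0, so C + 1 is used as the divisor; then e * C is still at most r /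
    2.\<close>
  define e where "e = r / (2 * (C + 1))"
  have e: "e > 0" using r C0 by (simp add: e_def)
  from LIMSEQ_D[OF h e] obtain N0 where N0: "\<And>n. n \<ge> N0 \<Longrightarrow> \<bar>h $ n\<bar> \<le> e * rising a $ n"
    using pa by (force simp: abs_divide pos_divide_less_eq less_imp_le)
  have bound: "\<bar>(h * g) $ n / rising (a + b) $ n\<bar>
      \<le> e * C + C * (\<Sum>i<N0. \<bar>h $ i\<bar> * (rising b $ (n - i) / rising (a + b) $ n))" if n: "n \<ge> N0" for n
  proof -
    have "\<bar>(h * g) $ n\<bar> \<le> (\<Sum>i=0..n. \<bar>h $ i\<bar> * \<bar>g $ (n - i)\<bar>)"
      unfolding fps_mult_nth by (rule order_trans[OF sum_abs]) (simp add: abs_mult)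
    also have "\<dots> \<le> (\<Sum>i=0..n. (e * rising a $ i + (if i < N0 then \<bar>h $ i\<bar> else 0)) * (C * rising b $ (n - i)))"
      by (intro sum_mono mult_mono g) (use N0 e pa in \<open>auto simp: less_imp_le\<close>)
    also have "\<dots> = e * C * (\<Sum>i=0..n. rising a $ i * rising b $ (n - i))
        + C * (\<Sum>i=0..n. (if i < N0 then \<bar>h $ i\<bar> * rising b $ (n - i) else 0))"
      unfolding sum_distrib_left sum.distrib[symmetric]
      by (intro sum.cong) (auto simp: algebra_simps)
    also have "(\<Sum>i=0..n. rising a $ i * rising b $ (n - i)) = rising (a + b) $ n"
      by (simp add: rising_mult[symmetric] fps_mult_nth)
    also have "(\<Sum>i=0..n. (if i < N0 then \<bar>h $ i\<bar> * rising b $ (n - i) else 0))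
        = (\<Sum>i<N0. \<bar>h $ i\<bar> * rising b $ (n - i))"
      using n by (intro sum.mono_neutral_cong_right) auto
    finally have "\<bar>(h * g) $ n\<bar> / rising (a + b) $ n
        \<le> (e * C * rising (a + b) $ n + C * (\<Sum>i<N0. \<bar>h $ i\<bar> * rising b $ (n - i))) / rising (a + b) $ n"
      using pab[of n] by (intro divide_right_mono) auto
    also have "\<dots> = e * C + C * (\<Sum>i<N0. \<bar>h $ i\<bar> * (rising b $ (n - i) / rising (a + b) $ n))"
      using pab[of n] by (simp add: add_divide_distrib sum_divide_distrib[symmetric])
    finally show ?thesis using pab[of n] by (simp add: abs_divide)
  qed
  have "(\<lambda>n. C * (\<Sum>i<N0. \<bar>h $ i\<bar> * (rising b $ (n - i) / rising (a + b) $ n))) \<longlonglongrightarrow> C * (\<Sum>i<N0. \<bar>h $ i\<bar> * 0)"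
    by (intro tendsto_intros rising_shift_negligible ab)
  then have "\<forall>\<^sub>F n in sequentially. C * (\<Sum>i<N0. \<bar>h $ i\<bar> * (rising b $ (n - i) / rising (a + b) $ n)) < r / 2"
    by (rule order_tendstoD) (use r in simp)
  then obtain N1 where N1: "\<And>n. n \<ge> N1 \<Longrightarrow> C * (\<Sum>i<N0. \<bar>h $ i\<bar> * (rising b $ (n - i) / rising (a + b) $ n)) < r / 2"
    by (auto simp: eventually_sequentially)
  have eC: "e * C \<le> r / 2"
    using r C0 by (simp add: e_def field_simps)
  show "\<exists>no. \<forall>n\<ge>no. norm ((h * g) $ n / rising (a + b) $ n - 0) < r"
  proof (intro exI[of _ "max N0 N1"] allI impI)
    fix n assume "max N0 N1 \<le> n"
    then show "norm ((h * g) $ n / rising (a + b) $ n - 0) < r"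
      using bound[of n] N1[of n] eC by (simp only: real_norm_def diff_0_right) linarith
  qed
qed

text \<open>Each factor is a multiple of its yardstick plus a negligible series. In the expanded
  product every term with a negligible factor is negligible, and the main term is exact by
  \<open>rising_mult\<close>.\<close>

lemma fps_mult_asymp:
  fixes f g :: "real fps"
  assumes ab: "a > 0" "b > 0"
    and f: "(\<lambda>n. f $ n / rising a $ n) \<longlonglongrightarrow> \<alpha>"
    and g: "(\<lambda>n. g $ n / rising b $ n) \<longlonglongrightarrow> \<beta>"
  shows "(\<lambda>n. (f * g) $ n / rising (a + b) $ n) \<longlonglongrightarrow> \<alpha> * \<beta>"
proof -
  have pa: "rising a $ n > 0" and pb: "rising b $ n > 0" and pab: "rising (a + b) $ n > 0" for n
    using ab by (auto intro!: rising_pos)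
  have ne: "rising a $ n \<noteq> 0" "rising b $ n \<noteq> 0" "rising (a + b) $ n \<noteq> 0" for n
    using pa[of n] pb[of n] pab[of n] by auto
  have "Bseq (\<lambda>n. g $ n / rising b $ n)" using g by (rule convergent_imp_Bseq[OF convergentI])
  then obtain C where "\<And>n. \<bar>g $ n / rising b $ n\<bar> \<le> C" by (auto simp: Bseq_def)
  then have C: "\<bar>g $ n\<bar> \<le> C * rising b $ n" for n
    using pb[of n] by (metis abs_divide abs_of_pos pos_divide_le_eq)
  define h where "h = f - fps_const \<alpha> * rising a"
  define k where "k = g - fps_const \<beta> * rising b"
  have "(\<lambda>n. f $ n / rising a $ n - \<alpha>) \<longlonglongrightarrow> \<alpha> - \<alpha>"
    by (intro tendsto_intros f)
  then have h: "(\<lambda>n. h $ n / rising a $ n) \<longlonglongrightarrow> 0"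
    by (simp add: h_def diff_divide_distrib ne)
  have "(\<lambda>n. g $ n / rising b $ n - \<beta>) \<longlonglongrightarrow> \<beta> - \<beta>"
    by (intro tendsto_intros g)
  then have k: "(\<lambda>n. k $ n / rising b $ n) \<longlonglongrightarrow> 0"
    by (simp add: k_def diff_divide_distrib ne)
  have 1: "(\<lambda>n. (h * g) $ n / rising (a + b) $ n) \<longlonglongrightarrow> 0"
    by (rule fps_mult_negligible[OF ab h C])
  have 2: "(\<lambda>n. (k * rising a) $ n / rising (b + a) $ n) \<longlonglongrightarrow> 0"
    by (rule fps_mult_negligible[of _ _ _ _ 1]) (use ab k pa in \<open>auto simp: less_imp_le\<close>)
  have eq: "f * g = h * g + fps_const \<alpha> * (k * rising a) + fps_const (\<alpha> * \<beta>) * rising (a + b)"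
    unfolding h_def k_def rising_mult[symmetric] fps_const_mult[symmetric]
    by (simp only: algebra_simps)
  have "(\<lambda>n. (h * g) $ n / rising (a + b) $ n + \<alpha> * ((k * rising a) $ n / rising (b + a) $ n) + \<alpha> * \<beta>)
      \<longlonglongrightarrow> 0 + \<alpha> * 0 + \<alpha> * \<beta>"
    by (intro tendsto_intros 1 2)
  moreover have "(f * g) $ n / rising (a + b) $ n
      = (h * g) $ n / rising (a + b) $ n + \<alpha> * ((k * rising a) $ n / rising (b + a) $ n) + \<alpha> * \<beta>" for n
    unfolding eq using ne(3)[of n] by (simp add: add_divide_distrib add.commute del: fps_const_mult)
  ultimately show ?thesis by simp
qed

lemma fps_power_asymp:
  fixes f :: "real fps"
  assumes "a > 0" "(\<lambda>n. f $ n / rising a $ n) \<longlonglongrightarrow> \<alpha>" "k \<ge> 1"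
  shows "(\<lambda>n. (f ^ k) $ n / rising (real k * a) $ n) \<longlonglongrightarrow> \<alpha> ^ k"
  using assms(3)
proof (induction k rule: dec_induct)
  case base
  then show ?case using assms(2) by simp
next
  case (step k)
  have "(\<lambda>n. (f * f ^ k) $ n / rising (a + real k * a) $ n) \<longlonglongrightarrow> \<alpha> * \<alpha> ^ k"
    using step assms by (intro fps_mult_asymp) auto
  then show ?case by (simp add: algebra_simps)
qed

text \<open>Positivity of a and b means that both exponents exceed -1, so the singular ends of the
  sum do no harm. Replacing the powers by the yardsticks makes the sum explicit.\<close>

lemma convolution_powr_bound:
  fixes f g :: "nat \<Rightarrow> real"
  assumes ab: "a > 0" "b > 0"
    and f: "\<And>n. 0 \<le> f n" "\<And>n. f n \<le> C * real n powr (a - 1)"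
    and g: "\<And>n. 0 \<le> g n" "\<And>n. g n \<le> D * real n powr (b - 1)"
  shows "\<exists>K. \<forall>n\<ge>1. (\<Sum>t\<le>n. f t * g (n - t)) \<le> K * real n powr (a + b - 1)"
proof -
  obtain A where A: "A > 0" "\<And>n. n \<ge> 1 \<Longrightarrow> real n powr (a - 1) \<le> A * rising a $ n"
    using powr_le_rising[OF ab(1)] by blast
  obtain B where B: "B > 0" "\<And>n. n \<ge> 1 \<Longrightarrow> real n powr (b - 1) \<le> B * rising b $ n"
    using powr_le_rising[OF ab(2)] by blast
  obtain E where E: "E > 0" "\<And>n. n \<ge> 1 \<Longrightarrow> rising (a + b) $ n \<le> E * real n powr (a + b - 1)"
    using rising_le_powr[of "a + b"] ab by auto
  have pos: "rising a $ n > 0" "rising b $ n > 0" for n using ab by (auto intro!: rising_pos)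
  have C: "C \<ge> 0" "D \<ge> 0" using f[of 1] g[of 1] by simp_all
  \<comment> \<open>At n = 0 the hypothesis reads \<open>f 0 \<le> 0\<close>, because
    \<open>0 powr x = 0\<close>. The comparison with the positive number \<open>rising a $ 0\<close>
    is then trivial, but the estimate from \<open>A\<close> applies only to n >= 1.\<close>
  have fb: "f n \<le> C * A * rising a $ n" for n
  proof (cases "n = 0")
    case True
    then show ?thesis using f[of 0] C A(1) pos(1)[of 0] by simp
  next
    case False
    then have "C * real n powr (a - 1) \<le> C * (A * rising a $ n)" using A(2)[of n] C by (intro mult_left_mono) auto
    then show ?thesis using f(2)[of n] by (simp add: mult_ac)
  qed
  have gb: "g n \<le> D * B * rising b $ n" for n
  proof (cases "n = 0")
    case True
    then show ?thesis using g[of 0] C B(1) pos(2)[of 0] by simp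
  next
    case False
    then have "D * real n powr (b - 1) \<le> D * (B * rising b $ n)" using B(2)[of n] C by (intro mult_left_mono) auto
    then show ?thesis using g(2)[of n] by (simp add: mult_ac)
  qed
  have "(\<Sum>t\<le>n. f t * g (n - t)) \<le> (C * A * (D * B) * E) * real n powr (a + b - 1)" if n: "n \<ge> 1" for n
  proof -
    have "(\<Sum>t\<le>n. f t * g (n - t)) \<le> (\<Sum>t\<le>n. (C * A * rising a $ t) * (D * B * rising b $ (n - t)))"
      by (intro sum_mono mult_mono fb gb) (use f g C A B pos in \<open>auto simp: less_imp_le\<close>)
    also have "\<dots> = (C * A * (D * B)) * rising (a + b) $ n"
      by (simp add: rising_mult[symmetric] fps_mult_nth sum_distrib_left mult_ac atMost_atLeast0)
    also have "\<dots> \<le> (C * A * (D * B)) * (E * real n powr (a + b - 1))"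
      using C A B E(2)[OF n] by (intro mult_left_mono) auto
    finally show ?thesis by (simp add: mult_ac)
  qed
  then show ?thesis by blast
qed

section \<open>Harris' and Janson's inequalities\<close>

text \<open>The expectation of f at a random subset of S that contains each x independently with
  probability \<open>p x\<close>. Written as a finite sum it allows induction on S without any
  measure theory.\<close>

definition bexp :: "('a \<Rightarrow> real) \<Rightarrow> 'a set \<Rightarrow> ('a set \<Rightarrow> real) \<Rightarrow> real" where
  "bexp p S f = (\<Sum>X\<in>Pow S. (\<Prod>x\<in>X. p x) * (\<Prod>x\<in>S - X. 1 - p x) * f X)"

lemma bexp_empty [simp]: "bexp p {} f = f {}"
  by (simp add: bexp_def)

lemma bexp_insert:
  assumes "finite S" "x \<notin> S"
  shows "bexp p (insert x S) f = p x * bexp p S (\<lambda>X. f (insert x X)) + (1 - p x) * bexp p S f"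
proof -
  have inj: "inj_on (insert x) (Pow S)"
    using assms(2) by (auto simp: inj_on_def)
  have disj: "Pow S \<inter> insert x ` Pow S = {}"
    using assms(2) by auto
  have "bexp p (insert x S) f =
      (\<Sum>X\<in>Pow S. (\<Prod>x\<in>X. p x) * (\<Prod>y\<in>insert x S - X. 1 - p y) * f X)
    + (\<Sum>X\<in>Pow S. (\<Prod>y\<in>insert x X. p y) * (\<Prod>y\<in>insert x S - insert x X. 1 - p y) * f (insert x X))"
    unfolding bexp_def Pow_insert using assms(1) disj inj
    by (subst sum.union_disjoint) (auto simp: sum.reindex)
  also have "(\<Sum>X\<in>Pow S. (\<Prod>x\<in>X. p x) * (\<Prod>y\<in>insert x S - X. 1 - p y) * f X)
      = (1 - p x) * bexp p S f"
    unfolding bexp_def sum_distrib_left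
  proof (rule sum.cong[OF refl])
    fix X assume "X \<in> Pow S"
    then have "insert x S - X = insert x (S - X)" using assms(2) by auto
    then show "(\<Prod>x\<in>X. p x) * (\<Prod>y\<in>insert x S - X. 1 - p y) * f X
        = (1 - p x) * ((\<Prod>x\<in>X. p x) * (\<Prod>x\<in>S - X. 1 - p x) * f X)"
      using assms by (simp add: mult_ac)
  qed
  also have "(\<Sum>X\<in>Pow S. (\<Prod>y\<in>insert x X. p y) * (\<Prod>y\<in>insert x S - insert x X. 1 - p y) * f (insert x X))
      = p x * bexp p S (\<lambda>X. f (insert x X))"
    unfolding bexp_def sum_distrib_left
  proof (rule sum.cong[OF refl])
    fix X assume X: "X \<in> Pow S"
    then have "insert x S - insert x X = S - X" "x \<notin> X" "finite X"
      using assms by (auto intro: finite_subset)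
    then show "(\<Prod>y\<in>insert x X. p y) * (\<Prod>y\<in>insert x S - insert x X. 1 - p y) * f (insert x X)
        = p x * ((\<Prod>x\<in>X. p x) * (\<Prod>x\<in>S - X. 1 - p x) * f (insert x X))"
      by (simp add: mult_ac)
  qed
  finally show ?thesis by simp
qed

lemma bexp_mono:
  assumes "\<And>x. x \<in> S \<Longrightarrow> 0 \<le> p x \<and> p x \<le> 1" "\<And>X. X \<subseteq> S \<Longrightarrow> f X \<le> g X"
  shows "bexp p S f \<le> bexp p S g"
  unfolding bexp_def using assms
  by (intro sum_mono mult_left_mono mult_nonneg_nonneg prod_nonneg) auto

lemma bexp_cong:
  assumes "\<And>X. X \<subseteq> S \<Longrightarrow> f X = g X"
  shows "bexp p S f = bexp p S g"
  unfolding bexp_def using assms by (intro sum.cong) auto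

lemma bexp_diff: "bexp p S (\<lambda>X. f X - g X) = bexp p S f - bexp p S g"
  by (simp add: bexp_def sum_subtractf right_diff_distrib)

lemma bexp_uminus: "bexp p S (\<lambda>X. - f X) = - bexp p S f"
  by (simp add: bexp_def sum_negf)

lemma bexp_sum: "bexp p S (\<lambda>X. \<Sum>i\<in>I. f i X) = (\<Sum>i\<in>I. bexp p S (f i))"
  unfolding bexp_def by (simp add: sum_distrib_left) (rule sum.swap)

lemma bexp_0 [simp]: "bexp p S (\<lambda>X. 0) = 0"
  by (simp add: bexp_def)

lemma bexp_1 [simp]: "finite S \<Longrightarrow> bexp p S (\<lambda>X. 1) = 1"
  by (induction S rule: finite_induct) (simp_all add: bexp_insert)

text \<open>Condition on whether x is chosen. Within each case the induction hypothesis applies, and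
  the two conditional means of f and of g are ordered the same way because both functions
  increase.\<close>

lemma harris:
  assumes "finite S" "\<And>x. x \<in> S \<Longrightarrow> 0 \<le> p x \<and> p x \<le> 1" "mono f" "mono g"
  shows "bexp p S f * bexp p S g \<le> bexp p S (\<lambda>X. f X * g X)"
  using assms
proof (induction S arbitrary: f g rule: finite_induct)
  case empty
  then show ?case by simp
next
  case (insert x S)
  let ?f = "\<lambda>X. f (insert x X)" and ?g = "\<lambda>X. g (insert x X)"
  have "mono (\<lambda>X. h (insert x X))" if "mono h" for h :: "'a set \<Rightarrow> real"
  proof (rule monoI)
    fix X Y :: "'a set" assume "X \<subseteq> Y"
    then have "insert x X \<subseteq> insert x Y" by auto
    with that show "h (insert x X) \<le> h (insert x Y)" by (rule monoD)
  qed
  then have mono: "mono ?f" "mono ?g"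
    using insert.prems(2,3) by auto
  define q where "q = p x"
  have q: "0 \<le> q" "q \<le> 1" using insert.prems(1)[of x] by (auto simp: q_def)
  define a1 a0 b1 b0 where ab: "a1 = bexp p S ?f" "a0 = bexp p S f" "b1 = bexp p S ?g" "b0 = bexp p S g"
  have "a0 \<le> a1" "b0 \<le> b1" unfolding ab
    using insert.prems(1) monoD[OF insert.prems(2) subset_insertI] monoD[OF insert.prems(3) subset_insertI]
    by (auto intro!: bexp_mono)
  \<comment> \<open>This product is the covariance of the two conditional means as functions of the
    choice at x.\<close>
  then have "0 \<le> (q * (1 - q)) * ((a1 - a0) * (b1 - b0))"
    using q by (intro mult_nonneg_nonneg) auto
  then have "(q * a1 + (1 - q) * a0) * (q * b1 + (1 - q) * b0) \<le> q * (a1 * b1) + (1 - q) * (a0 * b0)"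
    by (simp add: algebra_simps)
  also have "\<dots> \<le> q * bexp p S (\<lambda>X. ?f X * ?g X) + (1 - q) * bexp p S (\<lambda>X. f X * g X)"
    unfolding ab using q insert.prems insert.IH[of ?f ?g] insert.IH[of f g] mono
    by (intro add_mono mult_left_mono) auto
  finally show ?case
    using insert.hyps by (simp add: bexp_insert ab q_def)
qed

lemma harris_antimono:
  assumes "finite S" "\<And>x. x \<in> S \<Longrightarrow> 0 \<le> p x \<and> p x \<le> 1" "antimono f" "antimono g"
  shows "bexp p S f * bexp p S g \<le> bexp p S (\<lambda>X. f X * g X)"
  using harris[of S p "\<lambda>X. - f X" "\<lambda>X. - g X"] assms
  by (simp add: bexp_uminus mono_def antimono_def)

lemma harris_mixed:
  assumes "finite S" "\<And>x. x \<in> S \<Longrightarrow> 0 \<le> p x \<and> p x \<le> 1" "mono f" "antimono g"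
  shows "bexp p S (\<lambda>X. f X * g X) \<le> bexp p S f * bexp p S g"
  using harris[of S p f "\<lambda>X. - g X"] assms
  by (simp add: bexp_uminus mono_def antimono_def)

text \<open>The last hypothesis encodes that f does not look at the points of B, so it is
  independent of the event that B is contained. In Janson's argument f concerns the members of the
  family that are disjoint from B.\<close>

lemma bexp_indep:
  assumes "finite S" "B \<subseteq> S" "\<And>x X. x \<in> B \<Longrightarrow> f (insert x X) = f X"
  shows "bexp p S (\<lambda>X. of_bool (B \<subseteq> X) * f X) = (\<Prod>x\<in>B. p x) * bexp p S f"
  using assms
proof (induction S arbitrary: B f rule: finite_induct)
  case empty
  then show ?case by simp
next
  case (insert x S)
  show ?case
  proof (cases "x \<in> B")
    case True
    have fx: "\<And>X. f (insert x X) = f X" using insert.prems True by auto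
    have 1: "bexp p S (\<lambda>X. of_bool (B \<subseteq> insert x X) * f X)
        = bexp p S (\<lambda>X. of_bool (B - {x} \<subseteq> X) * f X)"
      by (rule bexp_cong) (auto simp: of_bool_def)
    have 2: "bexp p S (\<lambda>X. of_bool (B \<subseteq> X) * f X) = bexp p S (\<lambda>X. 0)"
      using True insert.hyps by (intro bexp_cong) auto
    have "(\<Prod>x\<in>B. p x) = p x * (\<Prod>x\<in>B - {x}. p x)"
      using True insert.prems insert.hyps by (intro prod.remove) (auto intro: finite_subset)
    moreover have "bexp p S (\<lambda>X. of_bool (B - {x} \<subseteq> X) * f X) = (\<Prod>x\<in>B - {x}. p x) * bexp p S f"
      using insert.prems by (intro insert.IH) auto
    ultimately show ?thesis
      unfolding bexp_insert[OF insert.hyps] fx 1 2 by (simp add: algebra_simps)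
  next
    case False
    have 1: "(B \<subseteq> insert x X) = (B \<subseteq> X)" for X using False by auto
    have "bexp p S (\<lambda>X. of_bool (B \<subseteq> X) * f X) = (\<Prod>x\<in>B. p x) * bexp p S f"
      using insert.prems False by (intro insert.IH) auto
    moreover have "bexp p S (\<lambda>X. of_bool (B \<subseteq> X) * f (insert x X)) = (\<Prod>x\<in>B. p x) * bexp p S (\<lambda>X. f (insert x X))"
      using insert.prems False by (intro insert.IH) (auto simp: insert_commute)
    ultimately show ?thesis
      unfolding bexp_insert[OF insert.hyps] 1 by (simp add: algebra_simps)
  qed
qed

lemma bexp_superset:
  assumes "finite S" "B \<subseteq> S"
  shows "bexp p S (\<lambda>X. of_bool (B \<subseteq> X)) = (\<Prod>x\<in>B. p x)"
  using bexp_indep[OF assms, of "\<lambda>_. 1" p] assms(1) by simp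

section \<open>Probability of containing no member of a family of finite sets\<close>

definition avoids :: "'a set set \<Rightarrow> 'a set \<Rightarrow> bool" where
  "avoids F X \<longleftrightarrow> (\<forall>B\<in>F. \<not> B \<subseteq> X)"

lemma antimono_avoids: "antimono (\<lambda>X. of_bool (avoids F X) :: real)"
  by (auto simp: antimono_def avoids_def of_bool_def)

lemma mono_superset: "mono (\<lambda>X. of_bool (B \<subseteq> X) :: real)"
  by (auto simp: mono_def of_bool_def)

lemma bexp_avoids_nonneg:
  assumes "finite S" "\<And>x. x \<in> S \<Longrightarrow> 0 \<le> p x \<and> p x \<le> 1"
  shows "0 \<le> bexp p S (\<lambda>X. of_bool (avoids F X))"
  using bexp_mono[of S p "\<lambda>_. 0" "\<lambda>X. of_bool (avoids F X)"] assms by simp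

text \<open>Not containing a given B is a decreasing event, and decreasing events are positively
  correlated by Harris' inequality; the members are added one at a time.\<close>

lemma avoids_ge_prod:
  assumes "finite S" "\<And>x. x \<in> S \<Longrightarrow> 0 \<le> p x \<and> p x \<le> 1" "finite F" "\<And>B. B \<in> F \<Longrightarrow> B \<subseteq> S"
  shows "(\<Prod>B\<in>F. 1 - (\<Prod>x\<in>B. p x)) \<le> bexp p S (\<lambda>X. of_bool (avoids F X))"
  using assms(3,4)
proof (induction F rule: finite_induct)
  case empty
  then show ?case using assms(1) by (simp add: avoids_def)
next
  case (insert B F)
  have B: "B \<subseteq> S" using insert.prems by auto
  have "1 - (\<Prod>x\<in>B. p x) = bexp p S (\<lambda>X. 1 - of_bool (B \<subseteq> X))"
    using assms(1) B by (simp add: bexp_diff bexp_superset)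
  also have "\<dots> = bexp p S (\<lambda>X. of_bool (avoids {B} X))"
    by (rule bexp_cong) (auto simp: avoids_def)
  finally have eq: "1 - (\<Prod>x\<in>B. p x) = bexp p S (\<lambda>X. of_bool (avoids {B} X))" .
  have "(\<Prod>B\<in>insert B F. 1 - (\<Prod>x\<in>B. p x))
      = bexp p S (\<lambda>X. of_bool (avoids {B} X)) * (\<Prod>B\<in>F. 1 - (\<Prod>x\<in>B. p x))"
    using insert.hyps by (simp add: eq)
  also have "\<dots> \<le> bexp p S (\<lambda>X. of_bool (avoids {B} X)) * bexp p S (\<lambda>X. of_bool (avoids F X))"
    using insert.prems by (intro mult_left_mono insert.IH bexp_avoids_nonneg assms(1,2)) auto
  also have "\<dots> \<le> bexp p S (\<lambda>X. of_bool (avoids {B} X) * of_bool (avoids F X))"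
    by (intro harris_antimono assms antimono_avoids)
  also have "\<dots> = bexp p S (\<lambda>X. of_bool (avoids (insert B F) X))"
    by (rule bexp_cong) (auto simp: avoids_def)
  finally show ?case .
qed

text \<open>The step in Boppana and Spencer's proof of Janson's inequality: only the members of \<open>F\<close>
  meeting \<open>B\<close> are handled by the union bound, and they are decoupled from the disjoint members
  by Harris' inequality.\<close>

lemma avoids_insert_le:
  assumes "finite S" "\<And>x. x \<in> S \<Longrightarrow> 0 \<le> p x \<and> p x \<le> 1"
    and "finite F" "\<And>C. C \<in> F \<Longrightarrow> C \<subseteq> S" "B \<subseteq> S"
  shows "bexp p S (\<lambda>X. of_bool (avoids (insert B F) X))
    \<le> bexp p S (\<lambda>X. of_bool (avoids F X)) *
        (1 - (\<Prod>x\<in>B. p x) + (\<Sum>C | C \<in> F \<and> C \<inter> B \<noteq> {}. \<Prod>x\<in>B \<union> C. p x))"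
proof -
  define D where "D = {C \<in> F. C \<inter> B \<noteq> {}}"
  define E where "E = {C \<in> F. C \<inter> B = {}}"
  define P where "P f = bexp p S (\<lambda>X. of_bool (f X))" for f
  define T where "T = (\<Prod>x\<in>B. p x) - (\<Sum>C\<in>D. \<Prod>x\<in>B \<union> C. p x)"
  have finD: "finite D" using assms(3) by (simp add: D_def)
  have E_ins: "avoids E (insert x X) = avoids E X" if "x \<in> B" for x X
  proof -
    have "(C \<subseteq> insert x X) = (C \<subseteq> X)" if "C \<in> E" for C
      using that \<open>x \<in> B\<close> by (auto simp: E_def)
    then show ?thesis by (auto simp: avoids_def)
  qed
  have BE: "P (\<lambda>X. B \<subseteq> X \<and> avoids E X) = (\<Prod>x\<in>B. p x) * P (avoids E)"
    unfolding P_def of_bool_conj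
    by (rule bexp_indep) (use assms E_ins in auto)
  have BCE: "P (\<lambda>X. (B \<union> C \<subseteq> X) \<and> avoids E X) \<le> (\<Prod>x\<in>B \<union> C. p x) * P (avoids E)" if "C \<in> D" for C
  proof -
    have "P (\<lambda>X. (B \<union> C \<subseteq> X) \<and> avoids E X) \<le> P (\<lambda>X. B \<union> C \<subseteq> X) * P (avoids E)"
      unfolding P_def of_bool_conj by (intro harris_mixed assms mono_superset antimono_avoids)
    also have "P (\<lambda>X. B \<union> C \<subseteq> X) = (\<Prod>x\<in>B \<union> C. p x)"
      unfolding P_def using assms that by (intro bexp_superset) (auto simp: D_def)
    finally show ?thesis .
  qed
  have "P (avoids E) * T \<le> P (\<lambda>X. B \<subseteq> X \<and> avoids E X) - (\<Sum>C\<in>D. P (\<lambda>X. (B \<union> C \<subseteq> X) \<and> avoids E X))"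
  proof -
    have "(\<Sum>C\<in>D. P (\<lambda>X. (B \<union> C \<subseteq> X) \<and> avoids E X)) \<le> (\<Sum>C\<in>D. (\<Prod>x\<in>B \<union> C. p x) * P (avoids E))"
      by (intro sum_mono BCE)
    then show ?thesis using BE
      by (simp add: T_def right_diff_distrib sum_distrib_left mult_ac)
  qed
  also have "\<dots> = bexp p S (\<lambda>X. of_bool (B \<subseteq> X \<and> avoids E X) - (\<Sum>C\<in>D. of_bool ((B \<union> C \<subseteq> X) \<and> avoids E X)))"
    unfolding P_def bexp_diff bexp_sum ..
  also have "\<dots> \<le> P (\<lambda>X. B \<subseteq> X \<and> avoids F X)"
    unfolding P_def
  proof (rule bexp_mono)
    fix X assume "X \<subseteq> S"
    show "of_bool (B \<subseteq> X \<and> avoids E X) - (\<Sum>C\<in>D. of_bool ((B \<union> C \<subseteq> X) \<and> avoids E X))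
      \<le> (of_bool (B \<subseteq> X \<and> avoids F X) :: real)"
    \<comment> \<open>The only case with content: X avoids \<open>E\<close> but not
      \<open>F\<close>, so it contains some member of \<open>D\<close>, and the subtracted sum is at
      least 1.\<close>
    proof (cases "B \<subseteq> X \<and> avoids E X \<and> \<not> avoids F X")
      case True
      then obtain C where C: "C \<in> D" "C \<subseteq> X"
        unfolding avoids_def E_def D_def by blast
      have "of_bool ((B \<union> C \<subseteq> X) \<and> avoids E X) \<le> (\<Sum>C\<in>D. of_bool ((B \<union> C \<subseteq> X) \<and> avoids E X) :: real)"
        by (rule member_le_sum) (use C finD in auto)
      then show ?thesis using True C by simp
    next
      case False
      moreover have "0 \<le> (\<Sum>C\<in>D. of_bool ((B \<union> C \<subseteq> X) \<and> avoids E X) :: real)"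
        by (rule sum_nonneg) simp
      ultimately show ?thesis by (cases "B \<subseteq> X"; cases "avoids E X"; cases "avoids F X") simp_all
    qed
  qed (use assms in auto)
  finally have key: "P (avoids E) * T \<le> P (\<lambda>X. B \<subseteq> X \<and> avoids F X)" .
  have P0: "0 \<le> P f" for f
    unfolding P_def using bexp_mono[of S p "\<lambda>_. 0" "\<lambda>X. of_bool (f X)"] assms by simp
  \<comment> \<open>Passing from \<open>E\<close> to the larger family \<open>F\<close> lowers the
    probability, which is the right direction only for T >= 0. For negative T the left side is at
    most 0.\<close>
  have "P (avoids F) * T \<le> P (\<lambda>X. B \<subseteq> X \<and> avoids F X)"
  proof (cases "T \<ge> 0")
    case True
    have "P (avoids F) \<le> P (avoids E)"
      unfolding P_def using assms(2) by (intro bexp_mono) (auto simp: avoids_def E_def)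
    then have "P (avoids F) * T \<le> P (avoids E) * T" using True by (rule mult_right_mono)
    then show ?thesis using key by linarith
  next
    case False
    then have "P (avoids F) * T \<le> 0" using P0 by (intro mult_nonneg_nonpos) auto
    then show ?thesis using P0[of "\<lambda>X. B \<subseteq> X \<and> avoids F X"] by linarith
  qed
  moreover have "P (avoids (insert B F)) = P (avoids F) - P (\<lambda>X. B \<subseteq> X \<and> avoids F X)"
    unfolding P_def bexp_diff[symmetric] by (rule bexp_cong) (auto simp: avoids_def)
  ultimately have "P (avoids (insert B F)) \<le> P (avoids F) * (1 - T)"
    by (simp add: right_diff_distrib)
  then show ?thesis
    by (simp add: P_def T_def D_def algebra_simps)
qed

text \<open>Adding a member B multiplies the bound by 1 - w + d, where w is the weight of B and d
  its overlap with the earlier members, and 1 + x <= exp x. The double sum counts both orders of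
  each intersecting pair, twice what the induction produces; this is harmless because it will tend
  to 0.\<close>

lemma janson:
  assumes "finite S" "\<And>x. x \<in> S \<Longrightarrow> 0 \<le> p x \<and> p x \<le> 1"
    and "finite F" "\<And>C. C \<in> F \<Longrightarrow> C \<subseteq> S"
  shows "bexp p S (\<lambda>X. of_bool (avoids F X))
    \<le> exp (- (\<Sum>B\<in>F. \<Prod>x\<in>B. p x) + (\<Sum>B\<in>F. \<Sum>C | C \<in> F \<and> C \<noteq> B \<and> C \<inter> B \<noteq> {}. \<Prod>x\<in>B \<union> C. p x))"
  using assms(3,4)
proof (induction F rule: finite_induct)
  case empty
  then show ?case using assms(1) by (simp add: avoids_def)
next
  case (insert B F)
  define w where "w C = (\<Prod>x\<in>C. p x)" for C
  have w0: "0 \<le> w C" if "C \<subseteq> S" for C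
    unfolding w_def using that assms(2) by (intro prod_nonneg) auto
  define d where "d F B = (\<Sum>C | C \<in> F \<and> C \<noteq> B \<and> C \<inter> B \<noteq> {}. w (B \<union> C))" for F B
  have eq: "{C \<in> F. C \<inter> B \<noteq> {}} = {C. C \<in> insert B F \<and> C \<noteq> B \<and> C \<inter> B \<noteq> {}}"
    using insert.hyps by auto
  have "bexp p S (\<lambda>X. of_bool (avoids (insert B F) X))
    \<le> bexp p S (\<lambda>X. of_bool (avoids F X)) * (1 - w B + d (insert B F) B)"
    using avoids_insert_le[OF assms(1,2) insert.hyps(1), where B=B] insert.prems
    unfolding d_def eq w_def by auto
  also have "\<dots> \<le> exp (- (\<Sum>B\<in>F. w B) + (\<Sum>C\<in>F. d F C)) * exp (- w B + d (insert B F) B)"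
  proof (rule mult_mono)
    show "bexp p S (\<lambda>X. of_bool (avoids F X)) \<le> exp (- (\<Sum>B\<in>F. w B) + (\<Sum>C\<in>F. d F C))"
      using insert.IH insert.prems by (simp add: w_def d_def)
    show "1 - w B + d (insert B F) B \<le> exp (- w B + d (insert B F) B)"
      using exp_ge_add_one_self[of "- w B + d (insert B F) B"] by linarith
    have "w B \<le> 1" unfolding w_def using insert.prems assms(2) by (intro prod_le_1) auto
    moreover have "0 \<le> d (insert B F) B"
      unfolding d_def using insert.prems by (intro sum_nonneg w0) auto
    ultimately show "0 \<le> 1 - w B + d (insert B F) B" by linarith
  qed auto
  also have "\<dots> = exp (- (\<Sum>B\<in>insert B F. w B) + (d (insert B F) B + (\<Sum>C\<in>F. d F C)))"
    using insert.hyps by (simp add: exp_add[symmetric] algebra_simps)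
  also have "\<dots> \<le> exp (- (\<Sum>B\<in>insert B F. w B) + (\<Sum>C\<in>insert B F. d (insert B F) C))"
  proof -
    have "(\<Sum>C\<in>F. d F C) \<le> (\<Sum>C\<in>F. d (insert B F) C)"
      unfolding d_def using insert.prems insert.hyps
      by (intro sum_mono sum_mono2 w0) auto
    then show ?thesis using insert.hyps by simp
  qed
  finally show ?case by (simp add: w_def d_def)
qed

section \<open>Representations as sums\<close>

text \<open>Representations by distinct summands. Such a set determines the represented number as
  its sum, so the families for different n are disjoint and Janson's sums split according to
  n.\<close>

definition rep_sets :: "nat \<Rightarrow> nat \<Rightarrow> nat set set" where
  "rep_sets k n = {B. finite B \<and> card B = k \<and> 0 \<notin> B \<and> \<Sum>B = n}"

text \<open>\<open>natpermute n k\<close> consists of the lists of length k with sum n, so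
  repetitions are allowed as in sA; n lies in sA exactly when A contains one of these supports. A
  support may have fewer than k elements.\<close>

definition rep_supports :: "nat \<Rightarrow> nat \<Rightarrow> nat set set" where
  "rep_supports k n = set ` {xs \<in> natpermute n k. 0 \<notin> set xs}"

lemma natpermute_iff: "xs \<in> natpermute n k \<longleftrightarrow> length xs = k \<and> sum_list xs = n"
  by (simp add: natpermute_def)

lemma rep_sets_eq: "rep_sets k n = set ` {xs \<in> natpermute n k. 0 \<notin> set xs \<and> distinct xs}"
proof (intro equalityI subsetI)
  fix B assume "B \<in> rep_sets k n"
  moreover from this have "sum_list (sorted_list_of_set B) = n"
    using sum_list_distinct_conv_sum_set[of "sorted_list_of_set B" "\<lambda>x. x"] by (simp add: rep_sets_def)
  ultimately have "B = set (sorted_list_of_set B)"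
    "sorted_list_of_set B \<in> {xs \<in> natpermute n k. 0 \<notin> set xs \<and> distinct xs}"
    by (auto simp: rep_sets_def natpermute_iff)
  then show "B \<in> set ` {xs \<in> natpermute n k. 0 \<notin> set xs \<and> distinct xs}" by blast
next
  fix B assume "B \<in> set ` {xs \<in> natpermute n k. 0 \<notin> set xs \<and> distinct xs}"
  then obtain xs where "B = set xs" "length xs = k" "sum_list xs = n" "0 \<notin> set xs" "distinct xs"
    by (auto simp: natpermute_iff)
  then show "B \<in> rep_sets k n"
    using sum_list_distinct_conv_sum_set[of xs "\<lambda>x. x"] by (simp add: rep_sets_def distinct_card)
qed

lemma finite_rep_supports [simp]: "finite (rep_supports k n)"
  by (simp add: rep_supports_def natpermute_finite)

lemma rep_sets_subset: "rep_sets k n \<subseteq> rep_supports k n"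
  unfolding rep_sets_eq rep_supports_def by blast

lemma finite_rep_sets [simp]: "finite (rep_sets k n)"
  using rep_sets_subset finite_rep_supports by (rule finite_subset)

lemma rep_supportsE:
  assumes "B \<in> rep_supports k n"
  obtains xs where "B = set xs" "length xs = k" "sum_list xs = n" "0 \<notin> set xs"
  using assms by (auto simp: rep_supports_def natpermute_iff)

lemma rep_supports_subset: "B \<in> rep_supports k n \<Longrightarrow> B \<subseteq> {1..n}"
proof (elim rep_supportsE, intro subsetI)
  fix xs x assume *: "B = set xs" "length xs = k" "sum_list xs = n" "0 \<notin> set xs" "x \<in> B"
  then have "x \<le> n" using member_le_sum_list[of x xs] by auto
  moreover have "x \<noteq> 0" using * by metis
  ultimately show "x \<in> {1..n}" by auto
qed

lemma rep_supports_card_le: "B \<in> rep_supports k n \<Longrightarrow> card B \<le> k"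
  by (metis card_length rep_supportsE)

lemma rep_supports_card_pos:
  assumes "B \<in> rep_supports k n" "k \<ge> 1" shows "card B \<ge> 1"
proof -
  obtain xs where xs: "B = set xs" "length xs = k" using assms(1) by (rule rep_supportsE)
  then have "xs \<noteq> []" using assms(2) by auto
  then show ?thesis using xs by (simp add: Suc_le_eq card_gt_0_iff)
qed

lemma rep_sets_iff_card: "B \<in> rep_sets k n \<longleftrightarrow> B \<in> rep_supports k n \<and> card B = k"
proof
  assume "B \<in> rep_sets k n"
  then show "B \<in> rep_supports k n \<and> card B = k" using rep_sets_subset by (auto simp: rep_sets_def)
next
  assume B: "B \<in> rep_supports k n \<and> card B = k"
  then obtain xs where "B = set xs" "length xs = k" "sum_list xs = n" "0 \<notin> set xs" using rep_supportsE by metis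
  moreover from this B have "distinct xs" by (simp add: card_distinct)
  ultimately show "B \<in> rep_sets k n" unfolding rep_sets_eq by (auto simp: natpermute_iff)
qed

lemma rep_sets_disjoint: "n \<noteq> m \<Longrightarrow> rep_sets k n \<inter> rep_sets k m = {}"
  by (auto simp: rep_sets_def)

lemma mem_sumset_iff:
  assumes "0 \<notin> A"
  shows "n \<in> sumset k A \<longleftrightarrow> (\<exists>B\<in>rep_supports k n. B \<subseteq> A)"
  using assms by (auto simp: sumset_def rep_supports_def natpermute_iff)

section \<open>Weights of lists of summands and of their supports\<close>

abbreviation list_weight :: "(nat \<Rightarrow> real) \<Rightarrow> nat list \<Rightarrow> real" where
  "list_weight p xs \<equiv> prod_list (map p xs)"

lemma fps_power_nth_list:
  assumes "k \<ge> 1"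
  shows "(Abs_fps p ^ k) $ n = (\<Sum>xs\<in>natpermute n k. list_weight p xs)"
proof -
  have "list_weight p xs = (\<Prod>j = 0..k - 1. Abs_fps p $ (xs ! j))" if "xs \<in> natpermute n k" for xs
  proof -
    have "list_weight p xs = (\<Prod>j = 0..<k. p (xs ! j))"
      using that by (simp add: prod.list_conv_set_nth natpermute_iff)
    also have "{0..<k} = {0..k - 1}" using assms by auto
    finally show ?thesis by simp
  qed
  then show ?thesis using assms by (simp add: fps_power_nth cong: sum.cong)
qed

lemma list_weight_nonneg:
  assumes "\<And>x. 0 \<le> p x" shows "0 \<le> list_weight p xs"
  by (induction xs) (use assms in auto)

lemma list_weight_distinct: "distinct xs \<Longrightarrow> list_weight p xs = (\<Prod>x\<in>set xs. p x)"
  by (simp add: prod.distinct_set_conv_list)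

lemma list_weight_zero: "p 0 = 0 \<Longrightarrow> 0 \<in> set xs \<Longrightarrow> list_weight p xs = 0"
  by (induction xs) auto

lemma list_weight_le_set:
  assumes "\<And>x. 0 \<le> p x" "\<And>x. p x \<le> 1"
  shows "list_weight p xs \<le> (\<Prod>x\<in>set xs. p x)"
proof (induction xs)
  case (Cons a xs)
  have "p a * list_weight p xs \<le> p a * (\<Prod>x\<in>set xs. p x)"
    using Cons assms by (intro mult_left_mono) auto
  also have "\<dots> \<le> (\<Prod>x\<in>set (a # xs). p x)"
    using assms by (cases "a \<in> set xs") (auto simp: insert_absorb intro!: mult_left_le_one_le prod_nonneg)
  finally show ?case by simp
qed simp

lemma rep_sets_weight_le:
  fixes p :: "nat \<Rightarrow> real"
  assumes "\<And>x. 0 \<le> p x" "k \<ge> 1"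
  shows "(\<Sum>B\<in>rep_sets k n. \<Prod>x\<in>B. p x) \<le> (Abs_fps p ^ k) $ n"
proof -
  have "(\<Sum>B\<in>rep_sets k n. \<Prod>x\<in>B. p x) \<le> (\<Sum>xs\<in>natpermute n k. list_weight p xs)"
  proof (rule sum_le_included[where i = set])
  show "\<forall>B\<in>rep_sets k n. \<exists>xs\<in>natpermute n k. set xs = B \<and> (\<Prod>x\<in>B. p x) \<le> list_weight p xs"
    unfolding rep_sets_eq by (auto simp: list_weight_distinct)
qed (auto simp: natpermute_finite intro: list_weight_nonneg assms(1))
  then show ?thesis by (simp add: fps_power_nth_list[OF assms(2)])
qed

text \<open>The coefficient sums over all ordered lists. A set of k distinct summands comes from k!
  lists. A list with a repetition has a support of fewer than k elements, weighs at most as much as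
  its support because p <= 1, and shares this support with at most k^k lists.\<close>

lemma power_nth_eq_rep_sets:
  fixes p :: "nat \<Rightarrow> real"
  assumes p: "\<And>x. 0 \<le> p x" "\<And>x. p x \<le> 1" "p 0 = 0" and k: "k \<ge> 1"
  shows "\<bar>(Abs_fps p ^ k) $ n - fact k * (\<Sum>B\<in>rep_sets k n. \<Prod>x\<in>B. p x)\<bar>
    \<le> real k ^ k * (\<Sum>B | B \<in> rep_supports k n \<and> card B < k. \<Prod>x\<in>B. p x)"
proof -
  define L where "L = {xs \<in> natpermute n k. 0 \<notin> set xs}"
  define D where "D = {xs \<in> L. distinct xs}"
  define E where "E = {xs \<in> L. \<not> distinct xs}"
  have fin: "finite D" "finite E" "finite L" by (auto simp: D_def E_def L_def natpermute_finite)
  have "(Abs_fps p ^ k) $ n = (\<Sum>xs\<in>L. list_weight p xs)"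
    unfolding fps_power_nth_list[OF k] L_def using p(3)
    by (intro sum.mono_neutral_right) (auto simp: natpermute_finite list_weight_zero)
  also have "\<dots> = (\<Sum>xs\<in>D. list_weight p xs) + (\<Sum>xs\<in>E. list_weight p xs)"
    unfolding D_def E_def using fin(3) by (subst sum.union_disjoint[symmetric]) (auto intro: sum.cong)
  also have "(\<Sum>xs\<in>D. list_weight p xs) = (\<Sum>B\<in>rep_sets k n. \<Sum>xs | xs \<in> D \<and> set xs = B. list_weight p xs)"
    using fin by (intro sum.group[symmetric]) (auto simp: rep_sets_eq D_def L_def)
  also have "\<dots> = (\<Sum>B\<in>rep_sets k n. fact k * (\<Prod>x\<in>B. p x))"
  proof (rule sum.cong[OF refl])
    fix B assume B: "B \<in> rep_sets k n"
    have "{xs \<in> D. set xs = B} = permutations_of_set B"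
    proof (intro equalityI subsetI)
      fix xs assume "xs \<in> permutations_of_set B"
      then have xs: "set xs = B" "distinct xs" by (auto simp: permutations_of_set_def)
      then have "sum_list xs = \<Sum>B" "length xs = card B"
        using sum_list_distinct_conv_sum_set[of xs "\<lambda>x. x"] distinct_card[of xs] by auto
      then show "xs \<in> {xs \<in> D. set xs = B}"
        using xs B by (auto simp: D_def L_def natpermute_iff rep_sets_def)
    qed (auto simp: permutations_of_set_def D_def)
    moreover have "list_weight p xs = (\<Prod>x\<in>B. p x)" if "xs \<in> permutations_of_set B" for xs
      using that by (auto simp: permutations_of_set_def list_weight_distinct)
    ultimately show "(\<Sum>xs | xs \<in> D \<and> set xs = B. list_weight p xs) = fact k * (\<Prod>x\<in>B. p x)"
      using B by (simp add: rep_sets_def)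
  qed
  finally have eq: "(Abs_fps p ^ k) $ n - fact k * (\<Sum>B\<in>rep_sets k n. \<Prod>x\<in>B. p x) = (\<Sum>xs\<in>E. list_weight p xs)"
    by (simp add: sum_distrib_left)
  let ?S = "{B. B \<in> rep_supports k n \<and> card B < k}"
  have img: "set ` E \<subseteq> ?S"
    by (auto simp: E_def L_def rep_supports_def natpermute_iff)
      (metis card_distinct card_length le_neq_implies_less)
  have "(\<Sum>xs\<in>E. list_weight p xs) = (\<Sum>B\<in>?S. \<Sum>xs | xs \<in> E \<and> set xs = B. list_weight p xs)"
    using fin img by (intro sum.group[symmetric]) auto
  also have "\<dots> \<le> (\<Sum>B\<in>?S. real k ^ k * (\<Prod>x\<in>B. p x))"
  proof (rule sum_mono)
    fix B assume B: "B \<in> ?S"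
    then have finB: "finite B" using rep_supports_subset[of B k n] by (auto intro: finite_subset)
    have "(\<Sum>xs | xs \<in> E \<and> set xs = B. list_weight p xs) \<le> real (card {xs. xs \<in> E \<and> set xs = B}) * (\<Prod>x\<in>B. p x)"
      using p list_weight_le_set[of p] by (intro sum_bounded_above) auto
    also have "\<dots> \<le> real k ^ k * (\<Prod>x\<in>B. p x)"
    proof (rule mult_right_mono)
      have "card {xs. xs \<in> E \<and> set xs = B} \<le> card {xs. set xs \<subseteq> B \<and> length xs = k}"
        using finB by (intro card_mono finite_lists_length_eq) (auto simp: E_def L_def natpermute_iff)
      also have "\<dots> = card B ^ k" using finB by (rule card_lists_length_eq)
      also have "\<dots> \<le> k ^ k" using B by (intro power_mono) auto
      finally show "real (card {xs. xs \<in> E \<and> set xs = B}) \<le> real k ^ k"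
        by (simp flip: of_nat_power)
    qed (use p in \<open>auto intro: prod_nonneg\<close>)
    finally show "(\<Sum>xs | xs \<in> E \<and> set xs = B. list_weight p xs) \<le> real k ^ k * (\<Prod>x\<in>B. p x)" .
  qed
  finally have "(\<Sum>xs\<in>E. list_weight p xs) \<le> real k ^ k * (\<Sum>B\<in>?S. \<Prod>x\<in>B. p x)"
    by (simp add: sum_distrib_left)
  moreover have "0 \<le> (\<Sum>xs\<in>E. list_weight p xs)"
    using p by (intro sum_nonneg list_weight_nonneg) auto
  ultimately show ?thesis unfolding eq by simp
qed

text \<open>A support \<open>{y\<^sub>1, \<dots>, y\<^sub>r}\<close> with multiplicities \<open>k\<^sub>1, \<dots>, k\<^sub>r\<close> is encoded by the list of the
  multiplicities and the list of the products \<open>k\<^sub>i y\<^sub>i\<close>, which sums to \<open>n\<close>.\<close>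

lemma rep_supports_weight_le:
  fixes p :: "nat \<Rightarrow> real"
  assumes p: "\<And>x. 0 \<le> p x" and c: "\<And>x j. 1 \<le> j \<Longrightarrow> j \<le> k \<Longrightarrow> p x \<le> c * p (j * x)" "c \<ge> 0" and r: "r \<ge> 1"
  shows "(\<Sum>B | B \<in> rep_supports k n \<and> card B = r. \<Prod>x\<in>B. p x) \<le> real k ^ r * c ^ r * (Abs_fps p ^ r) $ n"
proof -
  define K where "K = {ks. set ks \<subseteq> {1..k} \<and> length ks = r}"
  have finK: "finite K" and cardK: "card K = k ^ r"
    unfolding K_def by (auto simp: finite_lists_length_eq card_lists_length_eq)
  have "(\<Sum>B | B \<in> rep_supports k n \<and> card B = r. \<Prod>x\<in>B. p x)
      \<le> (\<Sum>(ks, zs)\<in>K \<times> natpermute n r. c ^ r * list_weight p zs)"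
  proof (rule sum_le_included[where i = "\<lambda>(ks, zs). set (map2 (\<lambda>j z. z div j) ks zs)"])
    show "\<forall>B\<in>{B. B \<in> rep_supports k n \<and> card B = r}.
       \<exists>y\<in>K \<times> natpermute n r. (case y of (ks, zs) \<Rightarrow> set (map2 (\<lambda>j z. z div j) ks zs)) = B \<and>
          (\<Prod>x\<in>B. p x) \<le> (case y of (ks, zs) \<Rightarrow> c ^ r * list_weight p zs)"
    proof
      fix B assume B: "B \<in> {B. B \<in> rep_supports k n \<and> card B = r}"
      then obtain xs where xs: "B = set xs" "length xs = k" "sum_list xs = n" "0 \<notin> set xs"
        by (auto elim: rep_supportsE)
      define ys where "ys = sorted_list_of_set B"
      have ys: "set ys = B" "distinct ys" "length ys = r"
        using B xs by (auto simp: ys_def)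
      define ks where "ks = map (count_list xs) ys"
      define zs where "zs = map (\<lambda>y. count_list xs y * y) ys"
      have cnt: "1 \<le> count_list xs y \<and> count_list xs y \<le> k" if "y \<in> set ys" for y
        using that ys xs count_le_length[of xs y] by (auto simp: Suc_le_eq count_list_0_iff intro!: Nat.gr0I)
      have "ks \<in> K" using cnt ys by (auto simp: K_def ks_def)
      moreover have "zs \<in> natpermute n r"
      proof -
        have "sum_list zs = (\<Sum>y\<in>set ys. count_list xs y * y)"
          using ys by (simp add: zs_def sum_list_distinct_conv_sum_set)
        also have "\<dots> = sum_list (map (\<lambda>x. x) xs)"
          using ys xs by (simp only: sum_list_map_eq_sum_count)
        finally show ?thesis using xs ys by (simp add: natpermute_iff zs_def)
      qed
      moreover have "set (map2 (\<lambda>j z. z div j) ks zs) = B"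
      proof -
        have "map2 (\<lambda>j z. z div j) ks zs = map (\<lambda>y. (count_list xs y * y) div count_list xs y) ys"
          unfolding ks_def zs_def by (induction ys) auto
        also have "\<dots> = map (\<lambda>y. y) ys" using cnt by (intro map_cong refl) force
        finally show ?thesis using ys by simp
      qed
      moreover have "(\<Prod>x\<in>B. p x) \<le> c ^ r * list_weight p zs"
      proof -
        have "(\<Prod>x\<in>B. p x) \<le> (\<Prod>y\<in>B. c * p (count_list xs y * y))"
          using ys cnt p c by (intro prod_mono) auto
        also have "\<dots> = c ^ r * list_weight p zs"
          using ys B by (simp add: prod.distrib zs_def prod.distinct_set_conv_list[symmetric] o_def flip: ys(1))
        finally show ?thesis .
      qed
      ultimately show "\<exists>y\<in>K \<times> natpermute n r. (case y of (ks, zs) \<Rightarrow> set (map2 (\<lambda>j z. z div j) ks zs)) = B \<and>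
          (\<Prod>x\<in>B. p x) \<le> (case y of (ks, zs) \<Rightarrow> c ^ r * list_weight p zs)"
        by (intro bexI[of _ "(ks, zs)"]) auto
    qed
  qed (use finK c in \<open>auto simp: natpermute_finite intro!: mult_nonneg_nonneg list_weight_nonneg p\<close>)
  also have "\<dots> = real k ^ r * c ^ r * (Abs_fps p ^ r) $ n"
    by (simp add: sum.cartesian_product[symmetric] fps_power_nth_list[OF r] cardK sum_distrib_left mult_ac)
  finally show ?thesis .
qed

text \<open>Split the union into D, B - D and C - D, where D is the intersection, with j elements
  and sum t. Here 1 <= j < k, since B and C meet, differ and have equal size. Forgetting how the
  three parts are related only adds nonnegative terms, and each part is then summed on its
  own.\<close>

lemma intersecting_weight_le:
  fixes p :: "nat \<Rightarrow> real"
  assumes p: "\<And>x. 0 \<le> p x"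
  shows "(\<Sum>B\<in>rep_sets k n. \<Sum>C | C \<in> rep_sets k m \<and> C \<noteq> B \<and> C \<inter> B \<noteq> {}. \<Prod>x\<in>B \<union> C. p x)
    \<le> (\<Sum>j=1..<k. \<Sum>t\<le>n. (Abs_fps p ^ j) $ t * ((Abs_fps p ^ (k - j)) $ (n - t) * (Abs_fps p ^ (k - j)) $ (m - t)))"
proof -
  define w where "w B = (\<Prod>x\<in>B. p x)" for B
  have w0: "0 \<le> w B" for B unfolding w_def by (intro prod_nonneg p)
  define T where "T = (SIGMA j:{1..<k}. SIGMA t:{..n}. rep_sets j t \<times> rep_sets (k - j) (n - t) \<times> rep_sets (k - j) (m - t))"
  have finT: "finite T" by (auto simp: T_def)
  have "(\<Sum>B\<in>rep_sets k n. \<Sum>C | C \<in> rep_sets k m \<and> C \<noteq> B \<and> C \<inter> B \<noteq> {}. w (B \<union> C))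
     = (\<Sum>(B, C)\<in>(SIGMA B:rep_sets k n. {C \<in> rep_sets k m. C \<noteq> B \<and> C \<inter> B \<noteq> {}}). w (B \<union> C))"
    by (subst sum.Sigma) auto
  also have "\<dots> \<le> (\<Sum>(j, t, D, E, F)\<in>T. w D * (w E * w F))"
  proof (rule sum_le_included[where i = "\<lambda>(j, t, D, E, F). (D \<union> E, D \<union> F)"])
    show "\<forall>x\<in>(SIGMA B:rep_sets k n. {C \<in> rep_sets k m. C \<noteq> B \<and> C \<inter> B \<noteq> {}}).
       \<exists>y\<in>T. (case y of (j, t, D, E, F) \<Rightarrow> (D \<union> E, D \<union> F)) = x \<and>
         (case x of (B, C) \<Rightarrow> w (B \<union> C)) \<le> (case y of (j, t, D, E, F) \<Rightarrow> w D * (w E * w F))"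
    proof clarify
      fix B C assume B: "B \<in> rep_sets k n" and C: "C \<in> rep_sets k m" and BC: "C \<noteq> B" "C \<inter> B \<noteq> {}"
      define D where "D = B \<inter> C"
      have fin: "finite B" "finite C" "finite D" using B C by (auto simp: rep_sets_def D_def)
      have card: "card B = k" "card C = k" using B C by (auto simp: rep_sets_def)
      have sub: "D \<subseteq> B" "D \<subseteq> C" by (auto simp: D_def)
      have "D \<noteq> B" using card_subset_eq[OF fin(2), of B] card BC by (auto simp: D_def)
      then have lt: "card D < k" using sub(1) psubset_card_mono[OF fin(1), of D] card by auto
      have gt: "1 \<le> card D" using BC fin by (auto simp: D_def Suc_le_eq card_gt_0_iff)
      have sB: "\<Sum>B = \<Sum>D + \<Sum>(B - D)" and sC: "\<Sum>C = \<Sum>D + \<Sum>(C - D)"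
        using sum.subset_diff[OF sub(1) fin(1), of "\<lambda>x. x"] sum.subset_diff[OF sub(2) fin(2), of "\<lambda>x. x"]
        by linarith+
      have D: "D \<in> rep_sets (card D) (\<Sum>D)"
        using B fin by (auto simp: rep_sets_def D_def)
      have BD: "B - D \<in> rep_sets (k - card D) (n - \<Sum>D)"
        using B sub fin card sB by (auto simp: rep_sets_def card_Diff_subset)
      have CD: "C - D \<in> rep_sets (k - card D) (m - \<Sum>D)"
        using C sub fin card sC by (auto simp: rep_sets_def card_Diff_subset)
      have Dn: "\<Sum>D \<le> n" using sB B by (auto simp: rep_sets_def)
      have un: "B \<union> C = D \<union> ((B - D) \<union> (C - D))" using sub by auto
      have "w (B \<union> C) = w D * (w (B - D) * w (C - D))"
        unfolding un w_def using fin
        by (subst prod.union_disjoint prod.union_disjoint; (force simp: D_def)?)+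
      then show "\<exists>y\<in>T. (case y of (j, t, D, E, F) \<Rightarrow> (D \<union> E, D \<union> F)) = (B, C) \<and>
         w (B \<union> C) \<le> (case y of (j, t, D, E, F) \<Rightarrow> w D * (w E * w F))"
        using D BD CD Dn lt gt sub
        by (intro bexI[of _ "(card D, \<Sum>D, D, B - D, C - D)"]) (auto simp: T_def)
    qed
  qed (use finT w0 in auto)
  also have "\<dots> = (\<Sum>j=1..<k. \<Sum>t\<le>n. (\<Sum>D\<in>rep_sets j t. w D) *
      ((\<Sum>E\<in>rep_sets (k - j) (n - t). w E) * (\<Sum>F\<in>rep_sets (k - j) (m - t). w F)))"
    unfolding T_def sum_product
    by (simp add: sum.Sigma[symmetric] sum.cartesian_product[symmetric] sum_distrib_left sum_distrib_right)
  also have "\<dots> \<le> (\<Sum>j=1..<k. \<Sum>t\<le>n. (Abs_fps p ^ j) $ t * ((Abs_fps p ^ (k - j)) $ (n - t) * (Abs_fps p ^ (k - j)) $ (m - t)))"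
  proof -
    have le: "(\<Sum>D\<in>rep_sets j t. w D) \<le> (Abs_fps p ^ j) $ t" if "j \<ge> 1" for j t
      unfolding w_def using p that by (rule rep_sets_weight_le)
    have ge: "0 \<le> (\<Sum>D\<in>rep_sets j t. w D)" for j t
      using w0 by (intro sum_nonneg)
    have W: "0 \<le> (Abs_fps p ^ j) $ t" if "j \<ge> 1" for j t
      using ge le[OF that] by (rule order_trans)
    show ?thesis
      by (intro sum_mono mult_mono mult_nonneg_nonneg le ge W) auto
  qed
  finally show ?thesis by (simp add: w_def)
qed

section \<open>Expected numbers of representations\<close>

text \<open>At 0 the value is 0, because \<open>0 powr x = 0\<close>. So the series has no constant
  term and its powers see positive summands only.\<close>

definition elem_prob :: "nat \<Rightarrow> nat \<Rightarrow> real" where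
  "elem_prob s n = (1 / real s) * real n powr (-1 + 1 / real s)"

abbreviation prob_fps :: "nat \<Rightarrow> real fps" where
  "prob_fps s \<equiv> Abs_fps (elem_prob s)"

abbreviation set_prob :: "nat \<Rightarrow> nat set \<Rightarrow> real" where
  "set_prob s B \<equiv> (\<Prod>x\<in>B. elem_prob s x)"

text \<open>The mu(n) of the overview; by independence the weight of a set is the probability that A
  contains it.\<close>

definition mean_reps :: "nat \<Rightarrow> nat \<Rightarrow> real" where
  "mean_reps s n = (\<Sum>B\<in>rep_sets s n. set_prob s B)"

definition limit_mean :: "nat \<Rightarrow> real" where
  "limit_mean s = Gamma (1 / real s) ^ s / (real s ^ s * fact s)"

lemma elem_prob_nonneg [simp]: "0 \<le> elem_prob s n"
  by (simp add: elem_prob_def)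

lemma elem_prob_0 [simp]: "elem_prob s 0 = 0"
  by (simp add: elem_prob_def)

lemma elem_prob_le_half:
  assumes "s \<ge> 2" shows "elem_prob s n \<le> 1 / 2"
proof (cases "n = 0")
  case False
  have "real n powr (-1 + 1 / real s) \<le> 1"
    using powr_mono[of "-1 + 1 / real s" 0 "real n"] False assms by simp
  then have "(1 / real s) * real n powr (-1 + 1 / real s) \<le> 1 / 2 * 1"
    using assms by (intro mult_mono) (auto simp: field_simps)
  then show ?thesis by (simp add: elem_prob_def)
qed simp

lemma elem_prob_le_1: "s \<ge> 2 \<Longrightarrow> elem_prob s n \<le> 1"
  using elem_prob_le_half[of s n] by linarith

lemma set_prob_nonneg: "0 \<le> set_prob s B"
  by (intro prod_nonneg) simp

lemma set_prob_le_elem: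
  assumes "s \<ge> 2" "finite B" "x \<in> B"
  shows "set_prob s B \<le> elem_prob s x"
proof -
  have "set_prob s B = elem_prob s x * set_prob s (B - {x})"
    using assms by (intro prod.remove)
  also have "\<dots> \<le> elem_prob s x * 1"
    using assms elem_prob_le_1 by (intro mult_left_mono prod_le_1) auto
  finally show ?thesis by simp
qed

text \<open>Provides c = s for \<open>rep_supports_weight_le\<close>: replacing x by j * x divides
  the probability by j^(1 - 1/s), which is at most s.\<close>

lemma elem_prob_mult:
  assumes "s \<ge> 2" "1 \<le> j" "j \<le> s"
  shows "elem_prob s x \<le> real s * elem_prob s (j * x)"
proof -
  have "1 = real s * real s powr (-1)" using assms by (simp add: powr_minus)
  also have "\<dots> \<le> real s * real s powr (-1 + 1 / real s)"
    using assms by (intro mult_left_mono powr_mono) auto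
  also have "\<dots> \<le> real s * real j powr (-1 + 1 / real s)"
    using assms by (intro mult_left_mono powr_mono2') auto
  finally have "1 * real x powr (-1 + 1 / real s) \<le> real s * real j powr (-1 + 1 / real s) * real x powr (-1 + 1 / real s)"
    by (intro mult_right_mono) auto
  then have "(1 / real s) * real x powr (-1 + 1 / real s)
      \<le> (1 / real s) * (real s * real j powr (-1 + 1 / real s) * real x powr (-1 + 1 / real s))"
    by (intro mult_left_mono) auto
  then show ?thesis by (simp add: elem_prob_def powr_mult mult_ac)
qed

lemma elem_prob_asymp:
  assumes "s \<ge> 2"
  shows "(\<lambda>n. prob_fps s $ n / rising (1 / real s) $ n) \<longlonglongrightarrow> Gamma (1 / real s) / real s"
proof -
  have pos: "1 / real s > 0" using assms by simp
  have "(\<lambda>n. (1 / real s) * inverse (rising (1 / real s) $ n / real n powr (1 / real s - 1)))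
      \<longlonglongrightarrow> (1 / real s) * inverse (1 / Gamma (1 / real s))"
    using Gamma_real_pos[OF pos]
    by (intro tendsto_mult[OF tendsto_const tendsto_inverse[OF rising_asymp[OF pos]]]) auto
  then show ?thesis by (simp add: elem_prob_def)
qed

lemma prob_fps_power_nonneg: "k \<ge> 1 \<Longrightarrow> 0 \<le> (prob_fps s ^ k) $ n"
  by (simp add: fps_power_nth_list sum_nonneg list_weight_nonneg)

lemma prob_fps_power_asymp:
  assumes "s \<ge> 2" "k \<ge> 1"
  shows "(\<lambda>n. (prob_fps s ^ k) $ n / rising (real k / real s) $ n) \<longlonglongrightarrow> (Gamma (1 / real s) / real s) ^ k"
  using fps_power_asymp[OF _ elem_prob_asymp[OF assms(1)] assms(2)] assms by simp

lemma prob_fps_power_le: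
  assumes s: "s \<ge> 2" and k: "k \<ge> 1"
  shows "\<exists>C\<ge>0. \<forall>n. (prob_fps s ^ k) $ n \<le> C * real n powr (real k / real s - 1)"
proof -
  have pos: "real k / real s > 0" using s k by simp
  obtain C where C: "C > 0" "\<And>n. n \<ge> 1 \<Longrightarrow> \<bar>(prob_fps s ^ k) $ n\<bar> \<le> C * rising (real k / real s) $ n"
    using convergent_ratio_bound[OF prob_fps_power_asymp[OF s k]] rising_pos[OF pos] by blast
  obtain D where D: "D > 0" "\<And>n. n \<ge> 1 \<Longrightarrow> rising (real k / real s) $ n \<le> D * real n powr (real k / real s - 1)"
    using rising_le_powr[OF pos] by blast
  have "(prob_fps s ^ k) $ n \<le> C * D * real n powr (real k / real s - 1)" for n
  proof (cases "n = 0")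
    case True
    then show ?thesis using k by (simp add: fps_power_zeroth zero_power)
  next
    case False
    then have "C * rising (real k / real s) $ n \<le> C * (D * real n powr (real k / real s - 1))"
      using C D by (intro mult_left_mono) auto
    then show ?thesis using C(2)[of n] False by (simp add: mult_ac)
  qed
  then show ?thesis using C(1) D(1) by (intro exI[of _ "C * D"]) auto
qed

text \<open>Supports of r elements weigh no more, up to a constant, than r-fold sums, that is,
  n^(r/s - 1). The worst case is r = s - 1.\<close>

lemma degenerate_reps_le:
  assumes s: "s \<ge> 2"
  shows "\<exists>C\<ge>0. \<forall>n\<ge>1. (\<Sum>B | B \<in> rep_supports s n \<and> card B < s. set_prob s B) \<le> C * real n powr (- 1 / real s)"
proof -
  have "\<forall>k\<in>{1..<s}. \<exists>C\<ge>0. \<forall>n. (prob_fps s ^ k) $ n \<le> C * real n powr (real k / real s - 1)"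
    using prob_fps_power_le[OF s] by auto
  then obtain C where C: "\<And>k. k \<in> {1..<s} \<Longrightarrow> C k \<ge> 0"
    "\<And>k n. k \<in> {1..<s} \<Longrightarrow> (prob_fps s ^ k) $ n \<le> C k * real n powr (real k / real s - 1)"
    unfolding bchoice_iff by blast
  have "(\<Sum>B | B \<in> rep_supports s n \<and> card B < s. set_prob s B)
      \<le> (\<Sum>r\<in>{1..<s}. real s ^ r * real s ^ r * C r) * real n powr (- 1 / real s)" if n: "n \<ge> 1" for n
  proof -
    have "(\<Sum>B | B \<in> rep_supports s n \<and> card B < s. set_prob s B)
      = (\<Sum>r\<in>{1..<s}. \<Sum>B | B \<in> {B \<in> rep_supports s n. card B < s} \<and> card B = r. set_prob s B)"
      using rep_supports_card_pos[of _ s n] s by (intro sum.group[symmetric]) auto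
    also have "\<dots> = (\<Sum>r\<in>{1..<s}. \<Sum>B | B \<in> rep_supports s n \<and> card B = r. set_prob s B)"
      by (intro sum.cong) auto
    also have "\<dots> \<le> (\<Sum>r\<in>{1..<s}. real s ^ r * real s ^ r * C r * real n powr (- 1 / real s))"
    proof (rule sum_mono)
      fix r assume r: "r \<in> {1..<s}"
      have "(\<Sum>B | B \<in> rep_supports s n \<and> card B = r. set_prob s B)
          \<le> real s ^ r * real s ^ r * (prob_fps s ^ r) $ n"
        using r elem_prob_mult[OF s] by (intro rep_supports_weight_le) auto
      also have "\<dots> \<le> real s ^ r * real s ^ r * (C r * real n powr (real r / real s - 1))"
        using C(2)[OF r] by (intro mult_left_mono) auto
      also have "\<dots> \<le> real s ^ r * real s ^ r * (C r * real n powr (- 1 / real s))"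
      proof -
        have "real r + 1 \<le> real s" using r by auto
        then have "(real r + 1) / real s \<le> 1" using s by simp
        then have "real r / real s - 1 \<le> - 1 / real s" by (simp add: add_divide_distrib)
        then show ?thesis using n C(1)[OF r] by (intro mult_left_mono powr_mono) auto
      qed
      finally show "(\<Sum>B | B \<in> rep_supports s n \<and> card B = r. set_prob s B)
          \<le> real s ^ r * real s ^ r * C r * real n powr (- 1 / real s)" by (simp add: mult_ac)
    qed
    finally show ?thesis by (simp add: sum_distrib_right)
  qed
  moreover have "0 \<le> (\<Sum>r\<in>{1..<s}. real s ^ r * real s ^ r * C r)"
    using C(1) by (intro sum_nonneg) auto
  ultimately show ?thesis by blast
qed

lemma mean_reps_tendsto:
  assumes s: "s \<ge> 2"
  shows "mean_reps s \<longlonglongrightarrow> limit_mean s"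
proof -
  obtain C where C: "C \<ge> 0" "\<And>n. n \<ge> 1 \<Longrightarrow>
      (\<Sum>B | B \<in> rep_supports s n \<and> card B < s. set_prob s B) \<le> C * real n powr (- 1 / real s)"
    using degenerate_reps_le[OF s] by blast
  \<comment> \<open>For k = s the yardstick is \<open>rising 1\<close>, whose coefficients are all
    1, so the coefficients themselves converge.\<close>
  have W: "(\<lambda>n. (prob_fps s ^ s) $ n) \<longlonglongrightarrow> (Gamma (1 / real s) / real s) ^ s"
    using prob_fps_power_asymp[OF s, of s] s by simp
  have "(\<lambda>n. real s ^ s * (C * real n powr (- 1 / real s))) \<longlonglongrightarrow> real s ^ s * (C * 0)"
  proof -
    have "- 1 / real s < 0" using s by simp
    then have "(\<lambda>n. real n powr (- 1 / real s)) \<longlonglongrightarrow> 0"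
      by (intro tendsto_neg_powr filterlim_real_sequentially)
    then show ?thesis by (intro tendsto_intros)
  qed
  then have lim: "(\<lambda>n. real s ^ s * (C * real n powr (- 1 / real s))) \<longlonglongrightarrow> 0" by simp
  have "(\<lambda>n. (prob_fps s ^ s) $ n - fact s * mean_reps s n) \<longlonglongrightarrow> 0"
  proof (rule Lim_null_comparison[OF _ lim])
    show "\<forall>\<^sub>F n in sequentially. norm ((prob_fps s ^ s) $ n - fact s * mean_reps s n)
        \<le> real s ^ s * (C * real n powr (- 1 / real s))"
      using eventually_ge_at_top[of 1]
    proof eventually_elim
      case (elim n)
      have "norm ((prob_fps s ^ s) $ n - fact s * mean_reps s n)
          \<le> real s ^ s * (\<Sum>B | B \<in> rep_supports s n \<and> card B < s. set_prob s B)"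
        using power_nth_eq_rep_sets[of "elem_prob s" s n] elem_prob_le_1[OF s] s
        by (simp add: mean_reps_def)
      also have "\<dots> \<le> real s ^ s * (C * real n powr (- 1 / real s))"
        using C(2)[OF elim] by (intro mult_left_mono) auto
      finally show ?case .
    qed
  qed
  from tendsto_diff[OF W this] have "(\<lambda>n. fact s * mean_reps s n) \<longlonglongrightarrow> (Gamma (1 / real s) / real s) ^ s"
    by simp
  then have "(\<lambda>n. fact s * mean_reps s n / fact s) \<longlonglongrightarrow> (Gamma (1 / real s) / real s) ^ s / fact s"
    by (intro tendsto_divide tendsto_const) auto
  then show ?thesis by (simp add: limit_mean_def power_divide field_simps)
qed

lemma limit_mean_pos: "s \<ge> 2 \<Longrightarrow> limit_mean s > 0"
  by (simp add: limit_mean_def Gamma_real_pos)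

text \<open>One of the s summands is at least n / s, and the other factors are at most 1. The bound
  makes the squared weights small in sum.\<close>

lemma set_prob_le_powr:
  assumes s: "s \<ge> 2" and n: "n \<ge> 1" and B: "B \<in> rep_supports s n"
  shows "set_prob s B \<le> real n powr (-1 + 1 / real s)"
proof -
  from B obtain xs where xs: "B = set xs" "length xs = s" "sum_list xs = n" by (rule rep_supportsE)
  have "\<exists>x\<in>set xs. real n / real s \<le> real x"
  proof (rule ccontr)
    assume "\<not> ?thesis"
    then have "\<And>x. x \<in> set xs \<Longrightarrow> real x < real n / real s" by force
    moreover have "xs \<noteq> []" using xs s by auto
    ultimately have "sum_list (map real xs) < sum_list (map (\<lambda>_. real n / real s) xs)"
      by (intro sum_list_strict_mono) auto
    moreover have "sum_list (map real ys) = real (sum_list ys)" for ys by (induction ys) auto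
    ultimately have "real (sum_list xs) < real n"
      using xs s by (simp add: sum_list_triv)
    then show False using xs by simp
  qed
  then obtain x where x: "x \<in> B" "real n / real s \<le> real x" using xs by auto
  have pos: "real n / real s > 0" using s n by simp
  have "set_prob s B \<le> elem_prob s x"
    using s x B rep_supports_subset[OF B] by (intro set_prob_le_elem) (auto intro: finite_subset)
  also have "\<dots> \<le> (1 / real s) * (real n / real s) powr (-1 + 1 / real s)"
    unfolding elem_prob_def using pos x s by (intro mult_left_mono powr_mono2') auto
  also have "\<dots> = (1 / real s) * real s powr (1 - 1 / real s) * real n powr (-1 + 1 / real s)"
  proof -
    define e where "e = 1 - 1 / real s"
    have e: "-1 + 1 / real s = - e" "1 - 1 / real s = e" by (auto simp: e_def)
    show ?thesis unfolding e using n s by (simp add: powr_divide powr_minus field_simps)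
  qed
  also have "\<dots> \<le> 1 * real n powr (-1 + 1 / real s)"
  proof (rule mult_right_mono)
    have "real s powr (1 - 1 / real s) \<le> real s powr 1" using s by (intro powr_mono) auto
    then show "1 / real s * real s powr (1 - 1 / real s) \<le> 1" using s by (simp add: field_simps)
  qed simp
  finally show ?thesis by simp
qed

text \<open>The form w + 2 w^2 is dictated by exp (-(w + 2 w^2)) <= 1 - w, which turns the product
  from Harris' inequality into an exponential. The excess over the mean comes from degenerate
  supports, of order n^(-1/s), and from squares, of order n^(-1 + 1/s); both are absorbed by
  n^(-1/(2s)).\<close>

lemma support_weight_le:
  assumes s: "s \<ge> 2"
  shows "\<exists>C\<ge>0. \<forall>n\<ge>1. (\<Sum>B\<in>rep_supports s n. set_prob s B + 2 * (set_prob s B)\<^sup>2)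
    \<le> mean_reps s n + C * real n powr (- 1 / (2 * real s))"
proof -
  obtain C where C: "C \<ge> 0" "\<And>n. n \<ge> 1 \<Longrightarrow>
      (\<Sum>B | B \<in> rep_supports s n \<and> card B < s. set_prob s B) \<le> C * real n powr (- 1 / real s)"
    using degenerate_reps_le[OF s] by blast
  have "Bseq (mean_reps s)" using mean_reps_tendsto[OF s] by (rule convergent_imp_Bseq[OF convergentI])
  then obtain M where M: "M > 0" "\<And>n. \<bar>mean_reps s n\<bar> \<le> M" by (auto simp: Bseq_def)
  let ?e = "- 1 / (2 * real s)"
  have "(\<Sum>B\<in>rep_supports s n. set_prob s B + 2 * (set_prob s B)\<^sup>2)
    \<le> mean_reps s n + (C + 2 * (M + C)) * real n powr ?e" if n: "n \<ge> 1" for n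
  proof -
    have split: "(\<Sum>B\<in>rep_supports s n. set_prob s B)
        = mean_reps s n + (\<Sum>B | B \<in> rep_supports s n \<and> card B < s. set_prob s B)"
    proof -
      have "rep_supports s n = rep_sets s n \<union> {B. B \<in> rep_supports s n \<and> card B < s}"
        using rep_sets_iff_card[of _ s n] rep_supports_card_le[of _ s n] by (auto simp: le_less)
      moreover have "rep_sets s n \<inter> {B. B \<in> rep_supports s n \<and> card B < s} = {}"
        using rep_sets_iff_card[of _ s n] by auto
      ultimately show ?thesis unfolding mean_reps_def
        by (subst sum.union_disjoint[symmetric]) auto
    qed
    have e1: "real n powr (- 1 / real s) \<le> real n powr ?e"
      using n s by (intro powr_mono) (auto simp: field_simps)
    have e2: "real n powr (-1 + 1 / real s) \<le> real n powr ?e"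
      using n s by (intro powr_mono) (auto simp: field_simps)
    have e3: "real n powr ?e \<le> 1"
      using powr_mono[of ?e 0 "real n"] n s by simp
    have deg: "(\<Sum>B | B \<in> rep_supports s n \<and> card B < s. set_prob s B) \<le> C * real n powr ?e"
      using C(2)[OF n] mult_left_mono[OF e1 C(1)] by linarith
    have "(\<Sum>B\<in>rep_supports s n. (set_prob s B)\<^sup>2) \<le> (\<Sum>B\<in>rep_supports s n. real n powr ?e * set_prob s B)"
    proof (rule sum_mono)
      fix B assume "B \<in> rep_supports s n"
      from set_prob_le_powr[OF s n this] e2 have "set_prob s B \<le> real n powr ?e" by linarith
      then show "(set_prob s B)\<^sup>2 \<le> real n powr ?e * set_prob s B"
        unfolding power2_eq_square by (intro mult_right_mono set_prob_nonneg)
    qed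
    also have "\<dots> = real n powr ?e * (\<Sum>B\<in>rep_supports s n. set_prob s B)"
      by (simp add: sum_distrib_left)
    also have "\<dots> \<le> real n powr ?e * (M + C)"
    proof (rule mult_left_mono)
      have "C * real n powr ?e \<le> C * 1" using e3 C(1) by (intro mult_left_mono)
      then show "(\<Sum>B\<in>rep_supports s n. set_prob s B) \<le> M + C"
        unfolding split using M(2)[of n] deg by linarith
    qed simp
    finally have sq: "(\<Sum>B\<in>rep_supports s n. (set_prob s B)\<^sup>2) \<le> real n powr ?e * (M + C)" .
    show ?thesis
      using sq deg by (simp add: sum.distrib split sum_distrib_left[symmetric] algebra_simps)
  qed
  moreover have "0 \<le> C + 2 * (M + C)" using C M by simp
  ultimately show ?thesis by blast
qed

text \<open>The share of Janson's double sum that comes from a representation of n and a different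
  one of m with a common summand; n = m is included.\<close>

definition overlap_weight :: "nat \<Rightarrow> nat \<Rightarrow> nat \<Rightarrow> real" where
  "overlap_weight s n m =
    (\<Sum>B\<in>rep_sets s n. \<Sum>C | C \<in> rep_sets s m \<and> C \<noteq> B \<and> C \<inter> B \<noteq> {}. set_prob s (B \<union> C))"

lemma overlap_weight_commute: "overlap_weight s n m = overlap_weight s m n"
proof -
  have "overlap_weight s n m = (\<Sum>C\<in>rep_sets s m. \<Sum>B | B \<in> rep_sets s n \<and> (C \<noteq> B \<and> C \<inter> B \<noteq> {}). set_prob s (B \<union> C))"
    unfolding overlap_weight_def by (rule sum.swap_restrict) auto
  also have "\<dots> = overlap_weight s m n"
    unfolding overlap_weight_def by (intro sum.cong) (auto simp: Un_commute Int_commute)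
  finally show ?thesis .
qed

text \<open>With common part of size j and sum t, the terms are of order t^(j/s - 1) ((n - t)(m -
  t))^((s-j)/s - 1). For n = m the second power may be -1 or less, beyond the reach of the
  convolution bound. So for m >= n the factor in m - t is bounded by (n - t)^(-1/(2s)) only; the
  exponent left at n - t still exceeds -1, and the exponents add up to -1/(2s). Symmetry covers m <
  n.\<close>

lemma overlap_weight_le:
  assumes s: "s \<ge> 2"
  shows "\<exists>C\<ge>0. \<forall>N\<ge>1. \<forall>n\<ge>N. \<forall>m\<ge>N. overlap_weight s n m \<le> C * real N powr (- 1 / (2 * real s))"
proof -
  let ?e = "1 / (2 * real s)"
  have "\<exists>K\<ge>0. \<forall>n\<ge>1. \<forall>m\<ge>n. (\<Sum>t\<le>n. (prob_fps s ^ j) $ t * ((prob_fps s ^ (s - j)) $ (n - t) * (prob_fps s ^ (s - j)) $ (m - t)))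
      \<le> K * real n powr (- ?e)" if j: "j \<in> {1..<s}" for j
  proof -
    obtain C where C: "C \<ge> 0" "\<And>n. (prob_fps s ^ j) $ n \<le> C * real n powr (real j / real s - 1)"
      using prob_fps_power_le[OF s, of j] j by auto
    obtain D where D: "D \<ge> 0" "\<And>n. (prob_fps s ^ (s - j)) $ n \<le> D * real n powr (real (s - j) / real s - 1)"
    proof -
      have "s - j \<ge> 1" using j by auto
      from prob_fps_power_le[OF s this] that show ?thesis by blast
    qed
    \<comment> \<open>One factor is kept, the other is weakened to a power of exponent -1/(2s). As s
      - j >= 1, the exponent (s-j)/s - 1/(2s) passed to the convolution bound is positive.\<close>
    define g where "g x = (prob_fps s ^ (s - j)) $ x * real x powr (- ?e)" for x
    have nn: "0 \<le> (prob_fps s ^ j) $ x" "0 \<le> (prob_fps s ^ (s - j)) $ x" for x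
      using j by (auto intro!: prob_fps_power_nonneg)
    have j1: "real j \<ge> 1" "real (s - j) \<ge> 1" "real (s - j) = real s - real j" using j by auto
    have b: "real (s - j) / real s - ?e > 0" "real j / real s > 0"
    proof -
      have "1 / (2 * real s) < 1 / real s" using s by (simp add: field_simps)
      also have "\<dots> \<le> real (s - j) / real s" using j1 by (intro divide_right_mono) auto
      finally show "real (s - j) / real s - ?e > 0" by simp
      show "real j / real s > 0" using j1 s by simp
    qed
    have gb: "g x \<le> D * real x powr ((real (s - j) / real s - ?e) - 1)" for x
    proof -
      have "g x \<le> D * real x powr (real (s - j) / real s - 1) * real x powr (- ?e)"
        unfolding g_def by (intro mult_right_mono D) auto
      also have "\<dots> = D * real x powr ((real (s - j) / real s - ?e) - 1)"
        by (simp add: mult.assoc powr_add[symmetric] algebra_simps)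
      finally show ?thesis .
    qed
    have g0: "0 \<le> g x" for x unfolding g_def by (intro mult_nonneg_nonneg nn) simp
    obtain K where K: "\<And>n. n \<ge> 1 \<Longrightarrow> (\<Sum>t\<le>n. (prob_fps s ^ j) $ t * g (n - t))
        \<le> K * real n powr (real j / real s + (real (s - j) / real s - ?e) - 1)"
      using convolution_powr_bound[OF b(2,1), of "\<lambda>n. (prob_fps s ^ j) $ n" C g D] nn(1) C(2) g0 gb by blast
    have exps: "real j / real s + (real (s - j) / real s - ?e) - 1 = - ?e"
      using s j1 by (simp add: field_simps)
    have "(\<Sum>t\<le>n. (prob_fps s ^ j) $ t * ((prob_fps s ^ (s - j)) $ (n - t) * (prob_fps s ^ (s - j)) $ (m - t)))
      \<le> D * \<bar>K\<bar> * real n powr (- ?e)" if n: "n \<ge> 1" "m \<ge> n" for n m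
    proof -
      have "(\<Sum>t\<le>n. (prob_fps s ^ j) $ t * ((prob_fps s ^ (s - j)) $ (n - t) * (prob_fps s ^ (s - j)) $ (m - t)))
        \<le> (\<Sum>t\<le>n. (prob_fps s ^ j) $ t * (D * g (n - t)))"
      proof (intro sum_mono mult_left_mono nn)
        fix t assume t: "t \<in> {..n}"
        show "(prob_fps s ^ (s - j)) $ (n - t) * (prob_fps s ^ (s - j)) $ (m - t) \<le> D * g (n - t)"
        \<comment> \<open>Negative powers decrease only on positive arguments. At t = n the left
          side vanishes instead, since it contains the constant coefficient of a positive power of
          \<open>prob_fps s\<close>.\<close>
        proof (cases "t = n")
          case True
          then show ?thesis using j by (auto simp: g_def fps_power_zeroth zero_power)
        next
          case False
          then have tn: "n - t \<ge> 1" "n - t \<le> m - t" using t n by auto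
          have "(prob_fps s ^ (s - j)) $ (m - t) \<le> D * real (m - t) powr (real (s - j) / real s - 1)"
            by (rule D)
          also have "\<dots> \<le> D * real (n - t) powr (real (s - j) / real s - 1)"
            using tn s j1 D(1) by (intro mult_left_mono powr_mono2') (auto simp: field_simps)
          also have "\<dots> \<le> D * real (n - t) powr (- ?e)"
            using tn s j1 D(1) by (intro mult_left_mono powr_mono) (auto simp: field_simps)
          finally have "(prob_fps s ^ (s - j)) $ (n - t) * (prob_fps s ^ (s - j)) $ (m - t)
              \<le> (prob_fps s ^ (s - j)) $ (n - t) * (D * real (n - t) powr (- ?e))"
            by (intro mult_left_mono nn)
          then show ?thesis by (simp add: g_def mult_ac)
        qed
      qed
      also have "\<dots> = D * (\<Sum>t\<le>n. (prob_fps s ^ j) $ t * g (n - t))"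
        by (simp add: sum_distrib_left mult_ac)
      also have "\<dots> \<le> D * (K * real n powr (- ?e))"
        using K[OF n(1)] D(1) unfolding exps by (intro mult_left_mono)
      also have "\<dots> \<le> D * (\<bar>K\<bar> * real n powr (- ?e))"
        using D(1) by (intro mult_left_mono mult_right_mono) auto
      finally show ?thesis by (simp add: mult_ac)
    qed
    then show ?thesis using D(1) by (intro exI[of _ "D * \<bar>K\<bar>"]) auto
  qed
  then have "\<forall>j\<in>{1..<s}. \<exists>K\<ge>0. \<forall>n\<ge>1. \<forall>m\<ge>n. (\<Sum>t\<le>n. (prob_fps s ^ j) $ t * ((prob_fps s ^ (s - j)) $ (n - t) * (prob_fps s ^ (s - j)) $ (m - t)))
      \<le> K * real n powr (- ?e)" by blast
  then obtain K where K: "\<And>j. j \<in> {1..<s} \<Longrightarrow> K j \<ge> 0"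
    "\<And>j n m. j \<in> {1..<s} \<Longrightarrow> n \<ge> 1 \<Longrightarrow> m \<ge> n \<Longrightarrow>
      (\<Sum>t\<le>n. (prob_fps s ^ j) $ t * ((prob_fps s ^ (s - j)) $ (n - t) * (prob_fps s ^ (s - j)) $ (m - t)))
      \<le> K j * real n powr (- ?e)"
    unfolding bchoice_iff by blast
  define C where "C = (\<Sum>j\<in>{1..<s}. K j)"
  have C0: "C \<ge> 0" unfolding C_def using K(1) by (intro sum_nonneg) auto
  have ordered: "overlap_weight s n m \<le> C * real n powr (- ?e)" if "n \<ge> 1" "m \<ge> n" for n m
  proof -
    have "overlap_weight s n m \<le> (\<Sum>j=1..<s. \<Sum>t\<le>n. (prob_fps s ^ j) $ t * ((prob_fps s ^ (s - j)) $ (n - t) * (prob_fps s ^ (s - j)) $ (m - t)))"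
      unfolding overlap_weight_def by (rule intersecting_weight_le) simp
    also have "\<dots> \<le> (\<Sum>j=1..<s. K j * real n powr (- ?e))"
      using K(2) that by (intro sum_mono) auto
    finally show ?thesis by (simp add: C_def sum_distrib_right)
  qed
  have "overlap_weight s n m \<le> C * real N powr (- ?e)" if "N \<ge> 1" "n \<ge> N" "m \<ge> N" for N n m
  proof -
    have "overlap_weight s n m \<le> C * real (min n m) powr (- ?e)"
      using ordered[of n m] ordered[of m n] that overlap_weight_commute[of s n m]
      by (cases "n \<le> m") (auto simp: min_def)
    also have "\<dots> \<le> C * real N powr (- ?e)"
      using that s C0 by (intro mult_left_mono powr_mono2') auto
    finally show ?thesis .
  qed
  then show ?thesis using C0 by (intro exI[of _ C]) auto
qed

section \<open>Probability that an interval is missed\<close>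

text \<open>Only an inequality can be used for supports, as one set may serve several numbers: {1,
  2} is a support for 4 and for 5 with three summands.\<close>

lemma sum_le_sum_UN:
  fixes f :: "'b \<Rightarrow> real"
  assumes "finite I" "\<And>i. i \<in> I \<Longrightarrow> finite (F i)" "\<And>x. 0 \<le> f x"
  shows "(\<Sum>x\<in>(\<Union>i\<in>I. F i). f x) \<le> (\<Sum>i\<in>I. \<Sum>x\<in>F i. f x)"
proof -
  have "(\<Sum>x\<in>(\<Union>i\<in>I. F i). f x) \<le> (\<Sum>(i, x)\<in>(SIGMA i:I. F i). f x)"
    by (rule sum_le_included[where i = snd]) (use assms in force)+
  also have "\<dots> = (\<Sum>i\<in>I. \<Sum>x\<in>F i. f x)" using assms by (simp add: sum.Sigma)
  finally show ?thesis .
qed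

text \<open>Dropping the degenerate supports makes avoidance more likely, so Janson's inequality is
  applied to distinct summands only. The square of \<open>card I\<close> counts pairs (n, m), each
  contributing one \<open>overlap_weight\<close>.\<close>

lemma avoids_prob_le:
  assumes s: "s \<ge> 2"
  obtains C where "C \<ge> 0" "\<And>N I S. N \<ge> 1 \<Longrightarrow> finite I \<Longrightarrow> I \<subseteq> {N..} \<Longrightarrow> finite S \<Longrightarrow> (\<And>n. n \<in> I \<Longrightarrow> {1..n} \<subseteq> S) \<Longrightarrow>
    bexp (elem_prob s) S (\<lambda>X. of_bool (avoids (\<Union>n\<in>I. rep_supports s n) X))
    \<le> exp (- (\<Sum>n\<in>I. mean_reps s n) + C * (real (card I))\<^sup>2 * real N powr (- 1 / (2 * real s)))"
proof -
  obtain C where C: "C \<ge> 0" "\<And>N n m. N \<ge> 1 \<Longrightarrow> n \<ge> N \<Longrightarrow> m \<ge> N \<Longrightarrow>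
      overlap_weight s n m \<le> C * real N powr (- 1 / (2 * real s))"
    using overlap_weight_le[OF s] by blast
  have "bexp (elem_prob s) S (\<lambda>X. of_bool (avoids (\<Union>n\<in>I. rep_supports s n) X))
    \<le> exp (- (\<Sum>n\<in>I. mean_reps s n) + C * (real (card I))\<^sup>2 * real N powr (- 1 / (2 * real s)))"
    if N: "N \<ge> 1" and I: "finite I" "I \<subseteq> {N..}" and S: "finite S" "\<And>n. n \<in> I \<Longrightarrow> {1..n} \<subseteq> S" for N I S
  proof -
    define F where "F = (\<Union>n\<in>I. rep_sets s n)"
    define c where "c = C * real N powr (- 1 / (2 * real s))"
    have F: "finite F" using I by (auto simp: F_def)
    have FS: "B \<subseteq> S" if "B \<in> F" for B
      using that S(2) rep_supports_subset rep_sets_subset unfolding F_def by blast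
    have p: "0 \<le> elem_prob s x \<and> elem_prob s x \<le> 1" for x using elem_prob_le_1[OF s] by simp
    have disj: "\<forall>n\<in>I. \<forall>m\<in>I. n \<noteq> m \<longrightarrow> rep_sets s n \<inter> rep_sets s m = {}"
      using rep_sets_disjoint by blast
    have "bexp (elem_prob s) S (\<lambda>X. of_bool (avoids (\<Union>n\<in>I. rep_supports s n) X))
        \<le> bexp (elem_prob s) S (\<lambda>X. of_bool (avoids F X))"
    proof (rule bexp_mono)
      have "F \<subseteq> (\<Union>n\<in>I. rep_supports s n)" unfolding F_def by (intro UN_mono rep_sets_subset) auto
      then show "of_bool (avoids (\<Union>n\<in>I. rep_supports s n) X) \<le> (of_bool (avoids F X) :: real)" for X
        by (auto simp: avoids_def)
    qed (use p in auto)
    also have "\<dots> \<le> exp (- (\<Sum>B\<in>F. set_prob s B) + (\<Sum>B\<in>F. \<Sum>C | C \<in> F \<and> C \<noteq> B \<and> C \<inter> B \<noteq> {}. set_prob s (B \<union> C)))"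
      using S(1) p F FS by (intro janson)
    also have "(\<Sum>B\<in>F. set_prob s B) = (\<Sum>n\<in>I. mean_reps s n)"
      unfolding F_def mean_reps_def using I disj by (intro sum.UNION_disjoint) auto
    also have "(\<Sum>B\<in>F. \<Sum>C | C \<in> F \<and> C \<noteq> B \<and> C \<inter> B \<noteq> {}. set_prob s (B \<union> C))
        = (\<Sum>B\<in>F. \<Sum>m\<in>I. \<Sum>C | C \<in> rep_sets s m \<and> C \<noteq> B \<and> C \<inter> B \<noteq> {}. set_prob s (B \<union> C))"
    proof (rule sum.cong[OF refl])
      fix B assume "B \<in> F"
      have "{C. C \<in> F \<and> C \<noteq> B \<and> C \<inter> B \<noteq> {}} = (\<Union>m\<in>I. {C. C \<in> rep_sets s m \<and> C \<noteq> B \<and> C \<inter> B \<noteq> {}})"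
        by (auto simp: F_def)
      then show "(\<Sum>C | C \<in> F \<and> C \<noteq> B \<and> C \<inter> B \<noteq> {}. set_prob s (B \<union> C))
          = (\<Sum>m\<in>I. \<Sum>C | C \<in> rep_sets s m \<and> C \<noteq> B \<and> C \<inter> B \<noteq> {}. set_prob s (B \<union> C))"
        using I disj by (simp only:) (intro sum.UNION_disjoint; force)
    qed
    also have "\<dots> = (\<Sum>n\<in>I. \<Sum>m\<in>I. overlap_weight s n m)"
    proof -
      have "(\<Sum>B\<in>F. \<Sum>m\<in>I. \<Sum>C | C \<in> rep_sets s m \<and> C \<noteq> B \<and> C \<inter> B \<noteq> {}. set_prob s (B \<union> C))
        = (\<Sum>n\<in>I. \<Sum>B\<in>rep_sets s n. \<Sum>m\<in>I. \<Sum>C | C \<in> rep_sets s m \<and> C \<noteq> B \<and> C \<inter> B \<noteq> {}. set_prob s (B \<union> C))"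
        unfolding F_def using I disj by (intro sum.UNION_disjoint) auto
      also have "\<dots> = (\<Sum>n\<in>I. \<Sum>m\<in>I. overlap_weight s n m)"
        unfolding overlap_weight_def by (intro sum.cong refl sum.swap)
      finally show ?thesis .
    qed
    also have "(\<Sum>n\<in>I. \<Sum>m\<in>I. overlap_weight s n m) \<le> (\<Sum>n\<in>I. \<Sum>m\<in>I. c)"
      unfolding c_def using I N by (intro sum_mono C(2)) auto
    also have "(\<Sum>n\<in>I. \<Sum>m\<in>I. c) = C * (real (card I))\<^sup>2 * real N powr (- 1 / (2 * real s))"
      by (simp add: c_def power2_eq_square)
    finally show ?thesis by simp
  qed
  from that[OF C(1) this] show thesis .
qed

lemma exp_le_one_minus:
  fixes x :: real
  assumes "0 \<le> x" "x \<le> 1 / 2"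
  shows "exp (- (x + 2 * x\<^sup>2)) \<le> 1 - x"
proof -
  have "- x - 2 * x\<^sup>2 \<le> ln (1 - x)" using assms by (rule ln_one_minus_pos_lower_bound)
  then have "exp (- x - 2 * x\<^sup>2) \<le> exp (ln (1 - x))" by (simp only: exp_le_cancel_iff)
  also have "exp (ln (1 - x)) = 1 - x" using assms by (intro exp_ln) linarith
  finally show ?thesis by simp
qed

text \<open>Every support has to be avoided here, the degenerate ones included. All weights are at
  most 1/2, already because of a single factor, so \<open>exp_le_one_minus\<close> applies to each
  term of the product from Harris' inequality.\<close>

lemma avoids_prob_ge:
  assumes s: "s \<ge> 2"
  obtains C where "C \<ge> 0" "\<And>N I S. N \<ge> 1 \<Longrightarrow> finite I \<Longrightarrow> I \<subseteq> {N..} \<Longrightarrow> finite S \<Longrightarrow> (\<And>n. n \<in> I \<Longrightarrow> {1..n} \<subseteq> S) \<Longrightarrow>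
    exp (- (\<Sum>n\<in>I. mean_reps s n) - C * real (card I) * real N powr (- 1 / (2 * real s)))
    \<le> bexp (elem_prob s) S (\<lambda>X. of_bool (avoids (\<Union>n\<in>I. rep_supports s n) X))"
proof -
  obtain C where C: "C \<ge> 0" "\<And>n. n \<ge> 1 \<Longrightarrow>
      (\<Sum>B\<in>rep_supports s n. set_prob s B + 2 * (set_prob s B)\<^sup>2) \<le> mean_reps s n + C * real n powr (- 1 / (2 * real s))"
    using support_weight_le[OF s] by blast
  have "exp (- (\<Sum>n\<in>I. mean_reps s n) - C * real (card I) * real N powr (- 1 / (2 * real s)))
    \<le> bexp (elem_prob s) S (\<lambda>X. of_bool (avoids (\<Union>n\<in>I. rep_supports s n) X))"
    if N: "N \<ge> 1" and I: "finite I" "I \<subseteq> {N..}" and S: "finite S" "\<And>n. n \<in> I \<Longrightarrow> {1..n} \<subseteq> S" for N I S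
  proof -
    define F where "F = (\<Union>n\<in>I. rep_supports s n)"
    have F: "finite F" using I by (auto simp: F_def)
    have FS: "B \<subseteq> S" if "B \<in> F" for B
      using that S(2) rep_supports_subset unfolding F_def by blast
    have p: "0 \<le> elem_prob s x \<and> elem_prob s x \<le> 1" for x using elem_prob_le_1[OF s] by simp
    have half: "set_prob s B \<le> 1 / 2" if B: "B \<in> F" for B
    proof -
      obtain n where n: "B \<in> rep_supports s n" using B by (auto simp: F_def)
      then have "card B \<ge> 1" using s by (intro rep_supports_card_pos) auto
      then obtain x where x: "x \<in> B" by (metis card.empty ex_in_conv not_one_le_zero)
      have "set_prob s B \<le> elem_prob s x"
        using s x rep_supports_subset[OF n] by (intro set_prob_le_elem) (auto intro: finite_subset)
      then show ?thesis using elem_prob_le_half[OF s, of x] by linarith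
    qed
    have "(\<Sum>B\<in>F. set_prob s B + 2 * (set_prob s B)\<^sup>2)
        \<le> (\<Sum>n\<in>I. \<Sum>B\<in>rep_supports s n. set_prob s B + 2 * (set_prob s B)\<^sup>2)"
      unfolding F_def using I by (intro sum_le_sum_UN add_nonneg_nonneg set_prob_nonneg) auto
    also have "\<dots> \<le> (\<Sum>n\<in>I. mean_reps s n + C * real N powr (- 1 / (2 * real s)))"
    proof (rule sum_mono)
      fix n assume "n \<in> I"
      then have n: "n \<ge> N" using I by auto
      have "C * real n powr (- 1 / (2 * real s)) \<le> C * real N powr (- 1 / (2 * real s))"
        using n N C(1) s by (intro mult_left_mono powr_mono2') auto
      then show "(\<Sum>B\<in>rep_supports s n. set_prob s B + 2 * (set_prob s B)\<^sup>2)
          \<le> mean_reps s n + C * real N powr (- 1 / (2 * real s))"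
        using C(2)[of n] n N by linarith
    qed
    also have "\<dots> = (\<Sum>n\<in>I. mean_reps s n) + C * real (card I) * real N powr (- 1 / (2 * real s))"
      by (simp add: sum.distrib)
    finally have "exp (- (\<Sum>n\<in>I. mean_reps s n) - C * real (card I) * real N powr (- 1 / (2 * real s)))
        \<le> exp (\<Sum>B\<in>F. - (set_prob s B + 2 * (set_prob s B)\<^sup>2))"
      by (simp only: exp_le_cancel_iff sum_negf)
    also have "\<dots> = (\<Prod>B\<in>F. exp (- (set_prob s B + 2 * (set_prob s B)\<^sup>2)))"
      using F by (rule exp_sum)
    also have "\<dots> \<le> (\<Prod>B\<in>F. 1 - set_prob s B)"
      using half set_prob_nonneg by (intro prod_mono conjI exp_le_one_minus exp_ge_zero) auto
    also have "\<dots> \<le> bexp (elem_prob s) S (\<lambda>X. of_bool (avoids F X))"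
      using S(1) p F FS by (intro avoids_ge_prod)
    finally show ?thesis by (simp add: F_def)
  qed
  from that[OF C(1) this] show thesis .
qed

section \<open>Second moment method and events that occur infinitely often\<close>

context prob_space begin

text \<open>Chebyshev's inequality for the number X of events that occur, whose mean is S: where
  none occurs, (X - S)^2 = S^2. In the second moment the diagonal contributes S and the other pairs
  at most c * S^2; in the application c tends to 1 and S to infinity.\<close>

lemma second_moment_prob:
  assumes J: "finite J" "\<And>i. i \<in> J \<Longrightarrow> F i \<in> events"
    and S: "S = (\<Sum>i\<in>J. prob (F i))" "S > 0"
    and c: "c \<ge> 0" "\<And>i j. i \<in> J \<Longrightarrow> j \<in> J \<Longrightarrow> i \<noteq> j \<Longrightarrow> prob (F i \<inter> F j) \<le> c * (prob (F i) * prob (F j))"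
  shows "prob (space M - (\<Union>i\<in>J. F i)) \<le> 1 / S + (c - 1)"
proof -
  define G where "G = space M - (\<Union>i\<in>J. F i)"
  have G: "G \<in> events" using J by (auto simp: G_def)
  have int: "integrable M (indicator (F i) :: 'a \<Rightarrow> real)" "integrable M (indicator (F i \<inter> F j) :: 'a \<Rightarrow> real)"
    if "i \<in> J" "j \<in> J" for i j using J(2) that by (auto simp: emeasure_eq_measure)
  have "S\<^sup>2 * prob G = (\<integral>x. S\<^sup>2 * indicator G x \<partial>M)" using G by simp
  also have "\<dots> \<le> (\<integral>x. (\<Sum>i\<in>J. \<Sum>j\<in>J. indicator (F i \<inter> F j) x) - 2 * S * (\<Sum>i\<in>J. indicator (F i) x) + S\<^sup>2 \<partial>M)"
  proof (rule integral_mono)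
    show "integrable M (\<lambda>x. S\<^sup>2 * indicator G x)" using G by (simp add: emeasure_eq_measure)
    show "integrable M (\<lambda>x. (\<Sum>i\<in>J. \<Sum>j\<in>J. indicator (F i \<inter> F j) x) - 2 * S * (\<Sum>i\<in>J. indicator (F i) x) + S\<^sup>2)"
      using int by (intro Bochner_Integration.integrable_add Bochner_Integration.integrable_diff
          Bochner_Integration.integrable_sum integrable_mult_right integrable_const) auto
    fix x assume "x \<in> space M"
    define X where "X = (\<Sum>i\<in>J. indicator (F i) x :: real)"
    have "(\<Sum>i\<in>J. \<Sum>j\<in>J. indicator (F i \<inter> F j) x) = X\<^sup>2"
      unfolding X_def power2_eq_square sum_product by (simp add: indicator_inter_arith)
    then have "(\<Sum>i\<in>J. \<Sum>j\<in>J. indicator (F i \<inter> F j) x) - 2 * S * X + S\<^sup>2 = (X - S)\<^sup>2"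
      by (simp add: power2_diff)
    moreover have "S\<^sup>2 * indicator G x \<le> (X - S)\<^sup>2"
    proof (cases "x \<in> G")
      case True
      then have "X = 0" unfolding X_def by (intro sum.neutral) (auto simp: G_def)
      then show ?thesis using True by simp
    qed simp
    ultimately show "S\<^sup>2 * indicator G x \<le> (\<Sum>i\<in>J. \<Sum>j\<in>J. indicator (F i \<inter> F j) x) - 2 * S * (\<Sum>i\<in>J. indicator (F i) x) + S\<^sup>2"
      unfolding X_def by simp
  qed
  also have "\<dots> = (\<Sum>i\<in>J. \<Sum>j\<in>J. prob (F i \<inter> F j)) - 2 * S * S + S\<^sup>2"
  proof -
    have "(\<integral>x. (\<Sum>i\<in>J. \<Sum>j\<in>J. indicator (F i \<inter> F j) x) \<partial>M) = (\<Sum>i\<in>J. \<Sum>j\<in>J. prob (F i \<inter> F j))"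
      using int J by (simp add: Bochner_Integration.integral_sum Bochner_Integration.integrable_sum cong: sum.cong)
    moreover have "(\<integral>x. (\<Sum>i\<in>J. indicator (F i) x) \<partial>M) = S"
      unfolding S(1) using int J by (simp add: Bochner_Integration.integral_sum cong: sum.cong)
    moreover have "integrable M (\<lambda>x. (\<Sum>i\<in>J. \<Sum>j\<in>J. indicator (F i \<inter> F j) x :: real))"
      "integrable M (\<lambda>x. 2 * S * (\<Sum>i\<in>J. indicator (F i) x :: real))"
      using int by (auto intro!: Bochner_Integration.integrable_sum integrable_mult_right)
    ultimately show ?thesis
      by (simp add: Bochner_Integration.integral_add Bochner_Integration.integral_diff prob_space)
  qed
  also have "(\<Sum>i\<in>J. \<Sum>j\<in>J. prob (F i \<inter> F j)) \<le> (\<Sum>i\<in>J. prob (F i) + (\<Sum>j\<in>J. c * (prob (F i) * prob (F j))))"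
  proof (rule sum_mono)
    fix i assume i: "i \<in> J"
    have "(\<Sum>j\<in>J. prob (F i \<inter> F j)) = prob (F i) + (\<Sum>j\<in>J - {i}. prob (F i \<inter> F j))"
      using J(1) i by (subst sum.remove[of J i]) auto
    also have "(\<Sum>j\<in>J - {i}. prob (F i \<inter> F j)) \<le> (\<Sum>j\<in>J - {i}. c * (prob (F i) * prob (F j)))"
      using i by (intro sum_mono c(2)) auto
    also have "\<dots> \<le> (\<Sum>j\<in>J. c * (prob (F i) * prob (F j)))"
      using J(1) c(1) by (intro sum_mono2) auto
    finally show "(\<Sum>j\<in>J. prob (F i \<inter> F j)) \<le> prob (F i) + (\<Sum>j\<in>J. c * (prob (F i) * prob (F j)))" by simp
  qed
  also have "\<dots> = S + c * S\<^sup>2"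
  proof -
    have "c * S\<^sup>2 = (\<Sum>i\<in>J. \<Sum>j\<in>J. c * (prob (F i) * prob (F j)))"
      unfolding power2_eq_square S(1) sum_product by (simp only: sum_distrib_left)
    then show ?thesis by (simp only: sum.distrib S(1)[symmetric])
  qed
  finally have "S\<^sup>2 * prob G \<le> S + (c - 1) * S\<^sup>2" by (simp add: power2_eq_square algebra_simps)
  then have "prob G \<le> (S + (c - 1) * S\<^sup>2) / S\<^sup>2"
    using S(2) by (simp add: pos_le_divide_eq mult.commute)
  also have "\<dots> = 1 / S + (c - 1)" using S(2) by (simp add: add_divide_distrib power2_eq_square)
  finally show ?thesis by (simp add: G_def)
qed

text \<open>To lie in no \<open>X n\<close> with n >= k means to lie in the complement of each of
  them, and these complements have arbitrarily small probability. The argument tolerates any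
  dependence between the events.\<close>

lemma AE_frequently_of_prob_tendsto_1:
  assumes X: "\<And>n. X n \<in> events" and lim: "(\<lambda>n. prob (space M - X n)) \<longlonglongrightarrow> 0"
  shows "AE \<omega> in M. \<forall>k. \<exists>n\<ge>k. \<omega> \<in> X n"
proof -
  have "AE \<omega> in M. \<exists>n\<ge>k. \<omega> \<in> X n" for k
  proof -
    define Z where "Z = (\<Inter>n\<in>{k..}. space M - X n)"
    have "Z = space M - (\<Union>n\<in>{k..}. X n)" by (auto simp: Z_def)
    then have Z: "Z \<in> events" using X by (auto intro!: sets.Diff sets.countable_UN'')
    have "prob Z \<le> 0"
    proof (rule tendsto_lowerbound[OF lim])
      show "\<forall>\<^sub>F n in sequentially. prob Z \<le> prob (space M - X n)"
        using eventually_ge_at_top[of k]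
        by eventually_elim (auto intro!: finite_measure_mono X simp: Z_def)
    qed simp
    then have "prob Z = 0" using measure_nonneg[of M Z] by linarith
    then have "Z \<in> null_sets M" using Z by (auto simp: null_sets_def emeasure_eq_measure)
    then have "AE \<omega> in M. \<omega> \<notin> Z" by (rule AE_not_in)
    then show ?thesis
      using AE_space by eventually_elim (auto simp: Z_def)
  qed
  then show ?thesis by (simp add: AE_all_countable)
qed

end

section \<open>From the probability space to finite sums\<close>

locale random_pseudo_powers = prob_space M for M :: "'a measure" +
  fixes A :: "'a \<Rightarrow> nat set" and s :: nat
  assumes s: "s \<ge> 2"
    and zero_notin: "\<And>\<omega>. 0 \<notin> A \<omega>"
    and mem_event: "\<And>n. {\<omega> \<in> space M. n \<in> A \<omega>} \<in> events"
    and indep: "indep_events (\<lambda>n. {\<omega> \<in> space M. n \<in> A \<omega>}) {1..}"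
    and mem_prob: "\<And>n. n \<ge> 1 \<Longrightarrow> prob {\<omega> \<in> space M. n \<in> A \<omega>} = elem_prob s n"
begin

lemma cylinder_event:
  assumes "finite X" "finite Y"
  shows "{\<omega> \<in> space M. X \<subseteq> A \<omega> \<and> Y \<inter> A \<omega> = {}} \<in> events"
proof -
  have "{\<omega> \<in> space M. X \<subseteq> A \<omega> \<and> Y \<inter> A \<omega> = {}}
      = {\<omega> \<in> space M. (\<forall>x\<in>X. \<omega> \<in> {\<omega> \<in> space M. x \<in> A \<omega>}) \<and> (\<forall>y\<in>Y. \<omega> \<notin> {\<omega> \<in> space M. y \<in> A \<omega>})}"
    by auto
  also have "\<dots> \<in> events"
    using assms mem_event by measurable
  finally show ?thesis .
qed

text \<open>\<open>indep_events\<close> speaks of intersections over nonempty sets of indices.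
  Excluded points are added one at a time: excluding y as well is the old event minus the one in
  which y is required.\<close>

lemma cylinder_prob:
  assumes "finite X" "finite Y" "X \<inter> Y = {}" "0 \<notin> X \<union> Y"
  shows "prob {\<omega> \<in> space M. X \<subseteq> A \<omega> \<and> Y \<inter> A \<omega> = {}}
    = (\<Prod>x\<in>X. elem_prob s x) * (\<Prod>y\<in>Y. 1 - elem_prob s y)"
  using assms(2,1,3,4)
proof (induction Y arbitrary: X rule: finite_induct)
  case empty
  show ?case
  proof (cases "X = {}")
    case True
    then show ?thesis by (simp add: prob_space)
  next
    case False
    have "X \<subseteq> {1..}" using empty.prems by (auto simp: Suc_le_eq intro: Nat.gr0I)
    then have "prob (\<Inter>x\<in>X. {\<omega> \<in> space M. x \<in> A \<omega>}) = (\<Prod>x\<in>X. prob {\<omega> \<in> space M. x \<in> A \<omega>})"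
      using indep empty.prems False unfolding indep_events_def by blast
    also have "\<dots> = (\<Prod>x\<in>X. elem_prob s x)"
      using \<open>X \<subseteq> {1..}\<close> by (intro prod.cong mem_prob) auto
    also have "(\<Inter>x\<in>X. {\<omega> \<in> space M. x \<in> A \<omega>}) = {\<omega> \<in> space M. X \<subseteq> A \<omega> \<and> {} \<inter> A \<omega> = {}}"
      using False by auto
    finally show ?thesis by simp
  qed
next
  case (insert y Y)
  let ?E = "\<lambda>X Y. {\<omega> \<in> space M. X \<subseteq> A \<omega> \<and> Y \<inter> A \<omega> = {}}"
  have "?E X (insert y Y) = ?E X Y - ?E (insert y X) Y" by auto
  then have "prob (?E X (insert y Y)) = prob (?E X Y) - prob (?E (insert y X) Y)"
    using insert by (simp only:) (intro finite_measure_Diff cylinder_event; auto)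
  also have "prob (?E X Y) = (\<Prod>x\<in>X. elem_prob s x) * (\<Prod>y\<in>Y. 1 - elem_prob s y)"
    using insert.prems by (intro insert.IH) auto
  also have "prob (?E (insert y X) Y) = (\<Prod>x\<in>insert y X. elem_prob s x) * (\<Prod>y\<in>Y. 1 - elem_prob s y)"
    using insert.prems insert.hyps by (intro insert.IH) auto
  finally show ?case using insert.prems insert.hyps by (simp add: algebra_simps)
qed

text \<open>The bridge to \<open>bexp\<close>: an event determined by the trace of A on a finite S
  is a disjoint union of cylinders, one for each admissible trace.\<close>

lemma
  assumes S: "finite S" "0 \<notin> S"
  shows restrict_event: "{\<omega> \<in> space M. Q (A \<omega> \<inter> S)} \<in> events"
    and restrict_prob: "prob {\<omega> \<in> space M. Q (A \<omega> \<inter> S)} = bexp (elem_prob s) S (\<lambda>X. of_bool (Q X))"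
proof -
  define E where "E X = {\<omega> \<in> space M. X \<subseteq> A \<omega> \<and> (S - X) \<inter> A \<omega> = {}}" for X
  let ?Q = "{X \<in> Pow S. Q X}"
  have eq: "{\<omega> \<in> space M. Q (A \<omega> \<inter> S)} = (\<Union>X\<in>?Q. E X)"
  proof (intro equalityI subsetI)
    fix \<omega> assume "\<omega> \<in> {\<omega> \<in> space M. Q (A \<omega> \<inter> S)}"
    then show "\<omega> \<in> (\<Union>X\<in>?Q. E X)"
      by (intro UN_I[of "A \<omega> \<inter> S"]) (auto simp: E_def)
  next
    fix \<omega> assume "\<omega> \<in> (\<Union>X\<in>?Q. E X)"
    then obtain X where X: "X \<subseteq> S" "Q X" "\<omega> \<in> E X" by auto
    then have "A \<omega> \<inter> S = X" by (auto simp: E_def)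
    then show "\<omega> \<in> {\<omega> \<in> space M. Q (A \<omega> \<inter> S)}" using X by (auto simp: E_def)
  qed
  have E: "E X \<in> events" if "X \<subseteq> S" for X
    unfolding E_def using S that by (intro cylinder_event) (auto intro: finite_subset)
  show "{\<omega> \<in> space M. Q (A \<omega> \<inter> S)} \<in> events"
    unfolding eq using S E by (intro sets.finite_UN) auto
  have "prob (\<Union>X\<in>?Q. E X) = (\<Sum>X\<in>?Q. prob (E X))"
    using S E by (intro finite_measure_finite_Union) (auto simp: disjoint_family_on_def E_def)
  also have "\<dots> = (\<Sum>X\<in>?Q. (\<Prod>x\<in>X. elem_prob s x) * (\<Prod>x\<in>S - X. 1 - elem_prob s x))"
    unfolding E_def using S by (intro sum.cong cylinder_prob) (auto intro: finite_subset)
  also have "\<dots> = bexp (elem_prob s) S (\<lambda>X. of_bool (Q X))"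
    unfolding bexp_def using S by (intro sum.mono_neutral_cong_left) auto
  finally show "prob {\<omega> \<in> space M. Q (A \<omega> \<inter> S)} = bexp (elem_prob s) S (\<lambda>X. of_bool (Q X))"
    unfolding eq .
qed

definition miss :: "nat set \<Rightarrow> 'a set" where
  "miss I = {\<omega> \<in> space M. sumset s (A \<omega>) \<inter> I = {}}"

lemma miss_eq:
  assumes "\<And>n. n \<in> I \<Longrightarrow> {1..n} \<subseteq> S"
  shows "miss I = {\<omega> \<in> space M. avoids (\<Union>n\<in>I. rep_supports s n) (A \<omega> \<inter> S)}"
proof -
  have "sumset s (A \<omega>) \<inter> I = {} \<longleftrightarrow> avoids (\<Union>n\<in>I. rep_supports s n) (A \<omega> \<inter> S)" for \<omega>
  proof -
    have "B \<subseteq> S" if "n \<in> I" "B \<in> rep_supports s n" for n B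
      using rep_supports_subset[OF that(2)] assms[OF that(1)] by blast
    then show ?thesis
      by (auto simp: avoids_def mem_sumset_iff[OF zero_notin] set_eq_iff)
  qed
  then show ?thesis by (simp add: miss_def)
qed

lemma
  assumes "finite I"
  shows miss_event: "miss I \<in> events"
    and miss_prob: "\<exists>S. finite S \<and> (\<forall>n\<in>I. {1..n} \<subseteq> S) \<and>
      prob (miss I) = bexp (elem_prob s) S (\<lambda>X. of_bool (avoids (\<Union>n\<in>I. rep_supports s n) X))"
proof -
  define S where "S = (\<Union>n\<in>I. {1..n})"
  have S: "finite S" "0 \<notin> S" "\<And>n. n \<in> I \<Longrightarrow> {1..n} \<subseteq> S" using assms by (auto simp: S_def)
  have eq: "miss I = {\<omega> \<in> space M. avoids (\<Union>n\<in>I. rep_supports s n) (A \<omega> \<inter> S)}"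
    using S(3) by (rule miss_eq)
  show "miss I \<in> events" unfolding eq by (rule restrict_event[OF S(1,2)])
  have "prob (miss I) = bexp (elem_prob s) S (\<lambda>X. of_bool (avoids (\<Union>n\<in>I. rep_supports s n) X))"
    unfolding eq by (rule restrict_prob[OF S(1,2)])
  then show "\<exists>S. finite S \<and> (\<forall>n\<in>I. {1..n} \<subseteq> S) \<and>
      prob (miss I) = bexp (elem_prob s) S (\<lambda>X. of_bool (avoids (\<Union>n\<in>I. rep_supports s n) X))"
    using S by blast
qed

lemma miss_Un: "miss I \<inter> miss J = miss (I \<union> J)"
  by (auto simp: miss_def)

lemma miss_prob_bounds:
  obtains C where "C \<ge> 0"
    "\<And>N I. N \<ge> 1 \<Longrightarrow> finite I \<Longrightarrow> I \<subseteq> {N..} \<Longrightarrow>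
      prob (miss I) \<le> exp (- (\<Sum>n\<in>I. mean_reps s n) + C * (real (card I))\<^sup>2 * real N powr (- 1 / (2 * real s)))"
    "\<And>N I. N \<ge> 1 \<Longrightarrow> finite I \<Longrightarrow> I \<subseteq> {N..} \<Longrightarrow>
      exp (- (\<Sum>n\<in>I. mean_reps s n) - C * real (card I) * real N powr (- 1 / (2 * real s))) \<le> prob (miss I)"
proof (rule avoids_prob_le[OF s], rule avoids_prob_ge[OF s])
  fix C D :: real
  assume C: "C \<ge> 0" and C2: "\<And>N I S. N \<ge> 1 \<Longrightarrow> finite I \<Longrightarrow> I \<subseteq> {N..} \<Longrightarrow> finite S \<Longrightarrow> (\<And>n. n \<in> I \<Longrightarrow> {1..n} \<subseteq> S) \<Longrightarrow>
      bexp (elem_prob s) S (\<lambda>X. of_bool (avoids (\<Union>n\<in>I. rep_supports s n) X))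
      \<le> exp (- (\<Sum>n\<in>I. mean_reps s n) + C * (real (card I))\<^sup>2 * real N powr (- 1 / (2 * real s)))"
  assume D: "D \<ge> 0" and D2: "\<And>N I S. N \<ge> 1 \<Longrightarrow> finite I \<Longrightarrow> I \<subseteq> {N..} \<Longrightarrow> finite S \<Longrightarrow> (\<And>n. n \<in> I \<Longrightarrow> {1..n} \<subseteq> S) \<Longrightarrow>
      exp (- (\<Sum>n\<in>I. mean_reps s n) - D * real (card I) * real N powr (- 1 / (2 * real s)))
      \<le> bexp (elem_prob s) S (\<lambda>X. of_bool (avoids (\<Union>n\<in>I. rep_supports s n) X))"
  show thesis
  proof (rule that[of "max C D"])
    show "0 \<le> max C D" using C by simp
    fix N :: nat and I :: "nat set" assume N: "N \<ge> 1" and I: "finite I" "I \<subseteq> {N..}"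
    obtain S where S: "finite S" "\<And>n. n \<in> I \<Longrightarrow> {1..n} \<subseteq> S"
      and eq: "prob (miss I) = bexp (elem_prob s) S (\<lambda>X. of_bool (avoids (\<Union>n\<in>I. rep_supports s n) X))"
      using miss_prob[OF I(1)] by blast
    have "prob (miss I) \<le> exp (- (\<Sum>n\<in>I. mean_reps s n) + C * (real (card I))\<^sup>2 * real N powr (- 1 / (2 * real s)))"
      unfolding eq using N I S by (intro C2)
    also have "\<dots> \<le> exp (- (\<Sum>n\<in>I. mean_reps s n) + max C D * (real (card I))\<^sup>2 * real N powr (- 1 / (2 * real s)))"
      unfolding exp_le_cancel_iff by (intro add_left_mono mult_right_mono) auto
    finally show "prob (miss I) \<le> exp (- (\<Sum>n\<in>I. mean_reps s n) + max C D * (real (card I))\<^sup>2 * real N powr (- 1 / (2 * real s)))" .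
    have "exp (- (\<Sum>n\<in>I. mean_reps s n) - max C D * real (card I) * real N powr (- 1 / (2 * real s)))
        \<le> exp (- (\<Sum>n\<in>I. mean_reps s n) - D * real (card I) * real N powr (- 1 / (2 * real s)))"
      unfolding exp_le_cancel_iff by (intro diff_left_mono mult_right_mono) auto
    also have "\<dots> \<le> prob (miss I)"
      unfolding eq using N I S by (intro D2)
    finally show "exp (- (\<Sum>n\<in>I. mean_reps s n) - max C D * real (card I) * real N powr (- 1 / (2 * real s))) \<le> prob (miss I)" .
  qed
qed

end

section \<open>Gaps\<close>

text \<open>\<open>enumerate\<close> counts from 0, so index n means the element b of number n + 1;
  the shift leaves the limsup unchanged.\<close>

abbreviation (input) gap_ratio :: "nat set \<Rightarrow> nat \<Rightarrow> ereal" where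
  "gap_ratio T n \<equiv> ereal ((real (enumerate T (Suc n)) - real (enumerate T n)) / ln (real (enumerate T n)))"

text \<open>Apply the hypothesis to N equal to the n-th element b itself, which is at least n and
  hence eventually large enough. The next element is then at most b + \<open>\<kappa>\<close> log
  b.\<close>

lemma limsup_gap_ratio_le:
  assumes k: "\<kappa> > 0"
    and hit: "\<forall>\<^sub>F N in sequentially. T \<inter> {N<..N + nat \<lfloor>\<kappa> * ln (real N)\<rfloor>} \<noteq> {}"
  shows "infinite T" "limsup (gap_ratio T) \<le> ereal \<kappa>"
proof -
  obtain N0 where N0: "\<And>N. N \<ge> N0 \<Longrightarrow> T \<inter> {N<..N + nat \<lfloor>\<kappa> * ln (real N)\<rfloor>} \<noteq> {}"
    using hit by (auto simp: eventually_sequentially)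
  show inf: "infinite T"
    unfolding infinite_nat_iff_unbounded
  proof
    fix m show "\<exists>n>m. n \<in> T" using N0[of "max N0 m"] by fastforce
  qed
  show "limsup (gap_ratio T) \<le> ereal \<kappa>"
  proof (rule Limsup_bounded, unfold eventually_sequentially, intro exI[of _ "max N0 2"] allI impI)
    fix n assume n: "max N0 2 \<le> n"
    define b where "b = enumerate T n"
    have b: "b \<ge> N0" "b \<ge> 2" using le_enumerate[OF inf, of n] n by (auto simp: b_def)
    then obtain x where x: "x \<in> T" "b < x" "x \<le> b + nat \<lfloor>\<kappa> * ln (real b)\<rfloor>" using N0[of b] by auto
    have "enumerate T (Suc n) \<le> x"
      unfolding enumerate_Suc''[OF inf] using x by (intro Least_le) (auto simp: b_def)
    also have "real x \<le> real b + \<kappa> * ln (real b)"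
    proof -
      have "real (nat \<lfloor>\<kappa> * ln (real b)\<rfloor>) \<le> \<kappa> * ln (real b)"
        using k b by (intro of_nat_floor mult_nonneg_nonneg) auto
      then show ?thesis using x(3) by linarith
    qed
    finally have "real (enumerate T (Suc n)) - real b \<le> \<kappa> * ln (real b)" by simp
    moreover have "ln (real b) > 0" using b by simp
    ultimately show "gap_ratio T n \<le> ereal \<kappa>"
      by (simp add: b_def[symmetric] pos_divide_le_eq)
  qed
qed

text \<open>The last element before the empty interval lies below a <= 2N, so its logarithm is at
  most log (2N). This is why the length is measured against log (2N). The inclusion in
  \<open>{2..}\<close> makes the logarithms positive.\<close>

lemma limsup_gap_ratio_ge:
  assumes inf: "infinite T" and T: "T \<subseteq> {2..}"
    and gap: "\<And>k. \<exists>N\<ge>k. \<exists>a L. N \<le> a \<and> a \<le> 2 * N \<and> \<kappa> * ln (2 * real N) \<le> real L \<and> T \<inter> {a..<a + L} = {}"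
    and k: "\<kappa> > 0"
  shows "ereal \<kappa> \<le> limsup (gap_ratio T)"
proof -
  have "\<exists>n\<ge>n0. ereal \<kappa> \<le> gap_ratio T n" for n0
  proof -
    obtain N a L where N: "N \<ge> Suc (enumerate T n0)" "N \<le> a" "a \<le> 2 * N"
      "\<kappa> * ln (2 * real N) \<le> real L" "T \<inter> {a..<a + L} = {}"
      using gap by blast
    \<comment> \<open>The first element not below a; it lies past the empty interval. Since N
      exceeds the element of index \<open>n0\<close>, a predecessor exists and has index at least
      \<open>n0\<close>.\<close>
    define m where "m = (LEAST m. a \<le> enumerate T m)"
    have ex: "a \<le> enumerate T a" by (rule le_enumerate[OF inf])
    have m: "a \<le> enumerate T m" unfolding m_def using ex by (rule LeastI)
    have "enumerate T n0 < enumerate T m" using m N by linarith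
    then have "n0 < m" using inf by simp
    then obtain n where n: "m = Suc n" "n \<ge> n0" by (cases m) auto
    have na: "enumerate T n < a"
      using not_less_Least[of n "\<lambda>m. a \<le> enumerate T m"] n(1) by (auto simp: m_def)
    have "enumerate T m \<in> T" using inf by (rule enumerate_in_set)
    with N(5) m have mL: "a + L \<le> enumerate T m" by force
    have n2: "enumerate T n \<ge> 2" using enumerate_in_set[OF inf, of n] T by auto
    have "\<kappa> * ln (real (enumerate T n)) \<le> \<kappa> * ln (2 * real N)"
      using k n2 na N by (intro mult_left_mono) auto
    also have "\<dots> \<le> real L" by (rule N)
    also have "\<dots> \<le> real (enumerate T (Suc n)) - real (enumerate T n)"
    proof -
      have "enumerate T n + L \<le> enumerate T (Suc n)" using mL na n(1) by simp
      then have "real (enumerate T n + L) \<le> real (enumerate T (Suc n))" by (simp only: of_nat_le_iff)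
      then show ?thesis by simp
    qed
    finally have "\<kappa> \<le> (real (enumerate T (Suc n)) - real (enumerate T n)) / ln (real (enumerate T n))"
      using n2 by (simp add: pos_le_divide_eq)
    then show ?thesis using n(2) by auto
  qed
  then show ?thesis
    using Limsup_lessD[of sequentially "gap_ratio T" "ereal \<kappa>"]
    by (force simp: eventually_sequentially not_le[symmetric])
qed

lemma sumset_ge:
  assumes "0 \<notin> A" "n \<in> sumset k A" shows "k \<le> n"
proof -
  obtain xs where xs: "n = sum_list xs" "length xs = k" "set xs \<subseteq> A" using assms(2) by (auto simp: sumset_def)
  then have "0 \<notin> set xs" using assms(1) by auto
  then have "length xs \<le> sum_list xs" by (induction xs) (auto simp: Suc_le_eq)
  then show ?thesis using xs by simp
qed

section \<open>Almost sure bounds for the gaps\<close>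

context random_pseudo_powers begin

text \<open>Choose l strictly between 1 / \<open>\<kappa>\<close> and lambda. Eventually mu(n) > l,
  so the interval is missed with probability O(N^(-l \<open>\<kappa>\<close>)), which is summable
  because l \<open>\<kappa>\<close> > 1.\<close>

lemma AE_hits_intervals:
  assumes k: "\<kappa> > 1 / limit_mean s"
  shows "AE \<omega> in M. \<forall>\<^sub>F N in sequentially. sumset s (A \<omega>) \<inter> {N<..N + nat \<lfloor>\<kappa> * ln (real N)\<rfloor>} \<noteq> {}"
proof (rule miss_prob_bounds)
  fix C assume C: "C \<ge> 0" "\<And>N I. N \<ge> 1 \<Longrightarrow> finite I \<Longrightarrow> I \<subseteq> {N..} \<Longrightarrow>
      prob (miss I) \<le> exp (- (\<Sum>n\<in>I. mean_reps s n) + C * (real (card I))\<^sup>2 * real N powr (- 1 / (2 * real s)))"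
    "\<And>N I. N \<ge> 1 \<Longrightarrow> finite I \<Longrightarrow> I \<subseteq> {N..} \<Longrightarrow>
      exp (- (\<Sum>n\<in>I. mean_reps s n) - C * real (card I) * real N powr (- 1 / (2 * real s))) \<le> prob (miss I)"
  define I where "I N = {N<..N + nat \<lfloor>\<kappa> * ln (real N)\<rfloor>}" for N
  define e where "e = 1 / (2 * real s)"
  have e: "e > 0" using s by (simp add: e_def)
  have lam: "limit_mean s > 0" using limit_mean_pos[OF s] .
  have k0: "\<kappa> > 0" using k lam by (meson less_trans zero_less_divide_1_iff)
  have "1 / \<kappa> < limit_mean s" using k k0 lam by (simp add: field_simps)
  then obtain l where l: "1 / \<kappa> < l" "l < limit_mean s" using dense by blast
  have l0: "l > 0" using l(1) k0 by (meson less_trans zero_less_divide_1_iff)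
  have lk: "l * \<kappa> > 1" using l(1) k0 by (simp add: field_simps)
  have "\<forall>\<^sub>F n in sequentially. mean_reps s n > l"
    using mean_reps_tendsto[OF s] l(2) by (rule order_tendstoD)
  then have ev1: "\<forall>\<^sub>F N in sequentially. \<forall>n\<ge>N. mean_reps s n > l" by (rule eventually_all_ge_at_top)
  have "(\<lambda>N. C * \<kappa>\<^sup>2 * ((ln (real N))\<^sup>2 * real N powr (- e))) \<longlonglongrightarrow> C * \<kappa>\<^sup>2 * 0"
    using e by (intro tendsto_mult tendsto_const) real_asymp
  then have ev2: "\<forall>\<^sub>F N in sequentially. C * \<kappa>\<^sup>2 * ((ln (real N))\<^sup>2 * real N powr (- e)) < 1"
    by (rule order_tendstoD) simp
  \<comment> \<open>In the constant, exp l pays for rounding the length down by at most 1, and exp 1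
    pays for Janson's error term, which is below 1 by \<open>ev2\<close>.\<close>
  have bound: "\<forall>\<^sub>F N in sequentially. norm (prob (miss (I N))) \<le> exp (l + 1) * real N powr (- (l * \<kappa>))"
    using ev1 ev2 eventually_ge_at_top[of 1]
  proof eventually_elim
    case (elim N)
    define L where "L = real (card (I N))"
    have ln0: "ln (real N) \<ge> 0" using elim by simp
    have Leq: "L = real (nat \<lfloor>\<kappa> * ln (real N)\<rfloor>)" by (simp add: L_def I_def)
    have L: "L \<le> \<kappa> * ln (real N)" "L \<ge> \<kappa> * ln (real N) - 1" "L \<ge> 0"
      unfolding Leq using k0 ln0 by (auto intro: of_nat_floor)
    have "prob (miss (I N)) \<le> exp (- (\<Sum>n\<in>I N. mean_reps s n) + C * L\<^sup>2 * real N powr (- 1 / (2 * real s)))"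
      unfolding L_def using elim by (intro C(2)) (auto simp: I_def)
    also have "\<dots> \<le> exp (- (l * (\<kappa> * ln (real N) - 1)) + 1)"
    proof -
      have "l * (\<kappa> * ln (real N) - 1) \<le> l * L" using L l0 by (intro mult_left_mono) auto
      also have "\<dots> = (\<Sum>n\<in>I N. l)" by (simp add: L_def)
      also have "\<dots> \<le> (\<Sum>n\<in>I N. mean_reps s n)"
        using elim(1) by (intro sum_mono) (auto simp: I_def less_imp_le)
      finally have 1: "l * (\<kappa> * ln (real N) - 1) \<le> (\<Sum>n\<in>I N. mean_reps s n)" .
      have "C * L\<^sup>2 * real N powr (- e) \<le> C * (\<kappa> * ln (real N))\<^sup>2 * real N powr (- e)"
        using L C(1) by (intro mult_right_mono mult_left_mono power_mono) auto
      also have "\<dots> \<le> 1" using elim(2) by (simp add: power_mult_distrib mult_ac)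
      finally have "C * L\<^sup>2 * real N powr (- 1 / (2 * real s)) \<le> 1" by (simp add: e_def)
      with 1 show ?thesis by simp
    qed
    also have "\<dots> = exp (l + 1) * real N powr (- (l * \<kappa>))"
      using elim(3) by (simp add: powr_def exp_add[symmetric] algebra_simps)
    finally show ?case by simp
  qed
  have "summable (\<lambda>N. exp (l + 1) * real N powr (- (l * \<kappa>)))"
    using lk by (intro summable_mult) (simp add: summable_real_powr_iff)
  then have "summable (\<lambda>N. prob (miss (I N)))"
    by (rule summable_comparison_test_ev[OF bound])
  then have "AE \<omega> in M. \<forall>\<^sub>F N in sequentially. \<omega> \<in> space M - miss (I N)"
    by (intro borel_cantelli_AE1 miss_event) (auto simp: I_def emeasure_eq_measure)
  then show ?thesis
    by eventually_elim (auto simp: miss_def I_def elim!: eventually_mono)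
qed

text \<open>Choose l strictly between lambda and 1 / \<open>\<kappa>\<close>. Each interval is
  missed with probability at least a constant times (2N)^(-\<open>\<theta>\<close>), where
  \<open>\<theta>\<close> = l \<open>\<kappa>\<close> < 1, and there are about N / log N intervals,
  so the expected number of missed ones tends to infinity.\<close>

lemma AE_misses_interval:
  assumes k: "0 < \<kappa>" "\<kappa> < 1 / limit_mean s"
  shows "AE \<omega> in M. \<forall>k. \<exists>N\<ge>k. \<exists>a L. N \<le> a \<and> a \<le> 2 * N \<and> \<kappa> * ln (2 * real N) \<le> real L
    \<and> sumset s (A \<omega>) \<inter> {a..<a + L} = {}"
proof (rule miss_prob_bounds)
  fix C assume C: "C \<ge> 0" "\<And>N I. N \<ge> 1 \<Longrightarrow> finite I \<Longrightarrow> I \<subseteq> {N..} \<Longrightarrow>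
      prob (miss I) \<le> exp (- (\<Sum>n\<in>I. mean_reps s n) + C * (real (card I))\<^sup>2 * real N powr (- 1 / (2 * real s)))"
    "\<And>N I. N \<ge> 1 \<Longrightarrow> finite I \<Longrightarrow> I \<subseteq> {N..} \<Longrightarrow>
      exp (- (\<Sum>n\<in>I. mean_reps s n) - C * real (card I) * real N powr (- 1 / (2 * real s))) \<le> prob (miss I)"
  define e where "e = 1 / (2 * real s)"
  have e: "e > 0" using s by (simp add: e_def)
  have lam: "limit_mean s > 0" using limit_mean_pos[OF s] .
  have "limit_mean s < 1 / \<kappa>" using k lam by (simp add: field_simps)
  then obtain l where l: "limit_mean s < l" "l < 1 / \<kappa>" using dense by blast
  have l0: "l > 0" using l(1) lam by linarith
  define \<theta> where "\<theta> = l * \<kappa>"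
  have \<theta>: "0 < \<theta>" "\<theta> < 1" using l(2) l0 k by (auto simp: \<theta>_def field_simps)
  \<comment> \<open>Rounding up makes every interval long enough. The first \<open>K N\<close>
    consecutive intervals of this length, starting at N, stay within [N, 2N].\<close>
  define L where "L N = nat \<lceil>\<kappa> * ln (2 * real N)\<rceil>" for N
  define I where "I N i = {N + i * L N..<N + i * L N + L N}" for N i
  define K where "K N = N div L N" for N
  define X where "X N = (\<Union>i<K N. miss (I N i))" for N
  \<comment> \<open>\<open>R\<close> bounds the rounded length \<open>L\<close> from above by an
    explicit real function. \<open>d\<close> then dominates the error terms of both bounds for one
    interval, and \<open>g\<close> is a lower bound for the expected number of missed
    intervals.\<close>
  define R where "R N = \<kappa> * ln (2 * real N) + 1" for N :: nat
  define d where "d N = C * (R N)\<^sup>2 * real N powr (- e)" for N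
  define g where "g N = (real N / R N - 1) * (exp (- l - 1) * (2 * real N) powr (- \<theta>))" for N

  have "\<forall>\<^sub>F n in sequentially. mean_reps s n < l"
    using mean_reps_tendsto[OF s] l(1) by (rule order_tendstoD)
  then have ev1: "\<forall>\<^sub>F N in sequentially. \<forall>n\<ge>N. mean_reps s n < l" by (rule eventually_all_ge_at_top)
  have "(\<lambda>N. C * ((\<kappa> * ln (2 * real N) + 1)\<^sup>2 * real N powr (- e))) \<longlonglongrightarrow> C * 0"
    using e k(1) by (intro tendsto_mult tendsto_const) real_asymp
  then have d_lim: "d \<longlonglongrightarrow> 0" by (simp add: d_def[abs_def] R_def mult.assoc)
  then have ev2: "\<forall>\<^sub>F N in sequentially. d N < 1" by (rule order_tendstoD) simp
  have "filterlim (\<lambda>N. (real N / (\<kappa> * ln (2 * real N) + 1) - 1) * (2 * real N) powr (- \<theta>)) at_top sequentially"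
    using \<theta> k(1) by real_asymp
  then have "filterlim (\<lambda>N. exp (- l - 1) * ((real N / (\<kappa> * ln (2 * real N) + 1) - 1) * (2 * real N) powr (- \<theta>))) at_top sequentially"
    by (rule filterlim_tendsto_pos_mult_at_top[OF tendsto_const, rotated]) simp
  then have g_lim: "filterlim g at_top sequentially"
    by (simp add: g_def[abs_def] R_def mult_ac)
  then have ev3: "\<forall>\<^sub>F N in sequentially. g N > 0" by (rule filterlim_at_top_dense[THEN iffD1, rule_format])

  have X_ev: "X N \<in> events" for N
    unfolding X_def I_def by (intro sets.finite_UN miss_event) auto

  have bound: "\<forall>\<^sub>F N in sequentially. prob (space M - X N) \<le> 1 / g N + (exp (6 * d N) - 1)"
    using ev1 ev2 ev3 eventually_ge_at_top[of 1]
  proof eventually_elim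
    case (elim N)
    have N: "N \<ge> 1" by (rule elim)
    have ln0: "ln (2 * real N) > 0" using N by simp
    have k_ln: "\<kappa> * ln (2 * real N) > 0" using k(1) ln0 by simp
    have L: "L N \<ge> 1" "real (L N) \<le> R N" "\<kappa> * ln (2 * real N) \<le> real (L N)"
      using k_ln by (auto simp: L_def R_def Suc_le_eq)
    have R: "R N \<ge> 1" using k_ln by (simp add: R_def)
    define p where "p i = prob (miss (I N i))" for i
    define S where "S = (\<Sum>i<K N. p i)"
    define m where "m J = (\<Sum>n\<in>J. mean_reps s n)" for J
    have I: "finite (I N i)" "I N i \<subseteq> {N..}" "card (I N i) = L N" for i
      by (auto simp: I_def)
    have disj: "I N i \<inter> I N j = {}" if "i \<noteq> j" for i j
    proof -
      have "I N i \<inter> I N j = {}" if "i < j" for i j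
      proof -
        have "Suc i * L N \<le> j * L N" using that by (intro mult_le_mono1) auto
        then show ?thesis by (auto simp: I_def)
      qed
      then show ?thesis using that by (metis Int_commute nat_neq_iff)
    qed
    have dL: "C * real (L N) * real N powr (- 1 / (2 * real s)) \<le> d N"
    proof -
      \<comment> \<open>The error on the Harris side is linear in the length; as R >= 1, it is
        absorbed by the quadratic one.\<close>
      have "real (L N) \<le> R N * R N" using L(2) R mult_right_mono[of 1 "R N" "R N"] by linarith
      then have "C * real (L N) * real N powr (- e) \<le> C * (R N)\<^sup>2 * real N powr (- e)"
        using C(1) by (intro mult_right_mono mult_left_mono) (auto simp: power2_eq_square)
      then show ?thesis by (simp add: d_def e_def)
    qed
    have p_ge: "exp (- m (I N i) - d N) \<le> p i" for i
    proof -
      have "exp (- m (I N i) - d N) \<le> exp (- m (I N i) - C * real (L N) * real N powr (- 1 / (2 * real s)))"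
        using dL by simp
      also have "\<dots> \<le> p i" unfolding p_def m_def I(3)[of i, symmetric] by (rule C(3)[OF N I(1,2)])
      finally show ?thesis .
    qed
    \<comment> \<open>The constant 6 is 4 + 2: the union of two intervals has 2 * L elements, so
      Janson's error is at most 4 * d, and replacing each exponential by the probability of its
      interval costs another d.\<close>
    have pair: "prob (miss (I N i) \<inter> miss (I N j)) \<le> exp (6 * d N) * (p i * p j)" if ij: "i \<noteq> j" for i j
    proof -
      have card: "card (I N i \<union> I N j) = 2 * L N"
        using card_Un_disjoint[OF I(1) I(1) disj[OF ij]] I(3) by simp
      have "prob (miss (I N i \<union> I N j)) \<le> exp (- m (I N i \<union> I N j)
          + C * (real (card (I N i \<union> I N j)))\<^sup>2 * real N powr (- 1 / (2 * real s)))"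
        unfolding m_def using I by (intro C(2)[OF N]) auto
      also have "C * (real (card (I N i \<union> I N j)))\<^sup>2 * real N powr (- 1 / (2 * real s)) \<le> 4 * d N"
      proof -
        have "C * (2 * real (L N))\<^sup>2 * real N powr (- e) \<le> C * (2 * R N)\<^sup>2 * real N powr (- e)"
          using C(1) L(2) by (intro mult_right_mono mult_left_mono power_mono) auto
        then show ?thesis by (simp add: card d_def e_def power_mult_distrib)
      qed
      also have "- m (I N i \<union> I N j) + 4 * d N = 6 * d N + ((- m (I N i) - d N) + (- m (I N j) - d N))"
        unfolding m_def using sum.union_disjoint[OF I(1) I(1) disj[OF ij], of "mean_reps s"] by simp
      also have "exp \<dots> = exp (6 * d N) * (exp (- m (I N i) - d N) * exp (- m (I N j) - d N))"
        by (simp only: exp_add)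
      also have "\<dots> \<le> exp (6 * d N) * (p i * p j)"
        using p_ge by (intro mult_left_mono mult_mono) (auto simp: p_def)
      finally show ?thesis by (simp add: miss_Un)
    qed
    have "g N \<le> S"
    proof -
      \<comment> \<open>In the factor exp (-l - 1), the l comes from the summand 1 in
        \<open>R\<close>, and the 1 from d < 1.\<close>
      have pl: "exp (- l - 1) * (2 * real N) powr (- \<theta>) \<le> p i" for i
      proof -
        have "m (I N i) \<le> (\<Sum>n\<in>I N i. l)"
          unfolding m_def using elim(1) by (intro sum_mono) (auto simp: I_def less_imp_le)
        also have "\<dots> = l * real (L N)" using I(3) by simp
        also have "\<dots> \<le> l * R N" using L(2) l0 by (intro mult_left_mono) auto
        finally have "m (I N i) \<le> \<theta> * ln (2 * real N) + l" by (simp add: R_def \<theta>_def algebra_simps)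
        then have "- l - 1 + - \<theta> * ln (2 * real N) \<le> - m (I N i) - d N" using elim(2) by linarith
        then have "exp (- l - 1 + - \<theta> * ln (2 * real N)) \<le> exp (- m (I N i) - d N)"
          by (simp only: exp_le_cancel_iff)
        also have "\<dots> \<le> p i" by (rule p_ge)
        also have "exp (- l - 1 + - \<theta> * ln (2 * real N)) = exp (- l - 1) * (2 * real N) powr (- \<theta>)"
          using N by (subst exp_add) (simp add: powr_def)
        finally show ?thesis .
      qed
      have "real N / R N - 1 \<le> real (K N)"
      proof -
        have "real N / R N \<le> real N / real (L N)" using L by (intro divide_left_mono) auto
        also have "\<dots> \<le> real (N div L N) + 1"
        proof -
          have "N < (N div L N + 1) * L N" using L(1) by (metis Suc_eq_plus1 dividend_less_div_times less_le_trans mult.commute mult_Suc zero_less_one add.commute)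
          then have "real N \<le> (real (N div L N) + 1) * real (L N)"
            by (metis less_imp_le of_nat_1 of_nat_add of_nat_le_iff of_nat_mult)
          then show ?thesis using L(1) by (simp add: pos_divide_le_eq)
        qed
        finally show ?thesis by (simp add: K_def)
      qed
      then have "g N \<le> real (K N) * (exp (- l - 1) * (2 * real N) powr (- \<theta>))"
        unfolding g_def by (intro mult_right_mono) auto
      also have "\<dots> = (\<Sum>i<K N. exp (- l - 1) * (2 * real N) powr (- \<theta>))" by simp
      also have "\<dots> \<le> S" unfolding S_def by (intro sum_mono pl)
      finally show ?thesis .
    qed
    have "prob (space M - X N) \<le> 1 / S + (exp (6 * d N) - 1)"
      unfolding X_def
    proof (rule second_moment_prob)
      show "S > 0" using \<open>g N \<le> S\<close> elim(3) by linarith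
    qed (use I(1) pair in \<open>auto simp: S_def p_def intro: miss_event\<close>)
    also have "1 / S \<le> 1 / g N" using \<open>g N \<le> S\<close> elim(3) by (intro divide_left_mono) auto
    finally show ?case by simp
  qed
  have "(\<lambda>N. 1 / g N + (exp (6 * d N) - 1)) \<longlonglongrightarrow> 0 + (exp (6 * 0) - 1)"
  proof (intro tendsto_intros d_lim)
    show "(\<lambda>N. 1 / g N) \<longlonglongrightarrow> 0"
      using tendsto_inverse_0_at_top[OF g_lim] by (simp add: inverse_eq_divide)
  qed
  then have lim: "(\<lambda>N. 1 / g N + (exp (6 * d N) - 1)) \<longlonglongrightarrow> 0" by simp
  have "(\<lambda>N. prob (space M - X N)) \<longlonglongrightarrow> 0"
    by (rule tendsto_sandwich[OF _ bound tendsto_const lim]) simp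
  from AE_frequently_of_prob_tendsto_1[OF X_ev this]
  show ?thesis
  proof eventually_elim
    case (elim \<omega>)
    show ?case
    proof
      fix k
      obtain N i where N: "N \<ge> max k 1" "i < K N" "\<omega> \<in> miss (I N i)"
        using elim unfolding X_def by blast
      have "i * L N \<le> N div L N * L N" using N(2) by (intro mult_le_mono1) (simp add: K_def)
      also have "\<dots> \<le> N" by simp
      finally have "N + i * L N \<le> 2 * N" by simp
      moreover have "\<kappa> * ln (2 * real N) \<le> real (L N)" unfolding L_def by linarith
      ultimately show "\<exists>N\<ge>k. \<exists>a L. N \<le> a \<and> a \<le> 2 * N \<and> \<kappa> * ln (2 * real N) \<le> real L
          \<and> sumset s (A \<omega>) \<inter> {a..<a + L} = {}"
        using N by (intro exI[of _ N] exI[of _ "N + i * L N"] exI[of _ "L N"] conjI) (auto simp: miss_def I_def)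
    qed
  qed
qed

text \<open>The exceptional null set depends on \<open>\<kappa>\<close>, so only countably many
  values are used: one sequence decreasing and one increasing to the limit.\<close>

lemma AE_limsup_gap_ratio:
  "AE \<omega> in M. limsup (gap_ratio (sumset s (A \<omega>))) = ereal (1 / limit_mean s)"
proof -
  define c where "c = 1 / limit_mean s"
  have c: "c > 0" using limit_mean_pos[OF s] by (simp add: c_def)
  have "AE \<omega> in M. \<forall>k. \<forall>\<^sub>F N in sequentially.
      sumset s (A \<omega>) \<inter> {N<..N + nat \<lfloor>(c + 1 / real (Suc k)) * ln (real N)\<rfloor>} \<noteq> {}"
    unfolding AE_all_countable by (intro allI AE_hits_intervals) (simp add: c_def)
  \<comment> \<open>Taking j + 2 in the denominator keeps the factor at least 1/2, since
    \<open>AE_misses_interval\<close> asks for a positive \<open>\<kappa>\<close>.\<close>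
  moreover have "AE \<omega> in M. \<forall>j. \<forall>k. \<exists>N\<ge>k. \<exists>a L. N \<le> a \<and> a \<le> 2 * N \<and>
      c * (1 - 1 / real (Suc (Suc j))) * ln (2 * real N) \<le> real L \<and> sumset s (A \<omega>) \<inter> {a..<a + L} = {}"
    unfolding AE_all_countable[where P = "\<lambda>j \<omega>. \<forall>k. _ j \<omega> k"]
  proof (intro allI AE_misses_interval)
    fix j
    show "0 < c * (1 - 1 / real (Suc (Suc j)))" using c by (intro mult_pos_pos) auto
    have "c * (1 - 1 / real (Suc (Suc j))) < c * 1" using c by (intro mult_strict_left_mono) auto
    then show "c * (1 - 1 / real (Suc (Suc j))) < 1 / limit_mean s" by (simp add: c_def)
  qed
  ultimately show ?thesis
  proof eventually_elim
    case (elim \<omega>)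
    let ?T = "sumset s (A \<omega>)"
    have T: "?T \<subseteq> {2..}" using sumset_ge[OF zero_notin] s by fastforce
    have up: "infinite ?T" "limsup (gap_ratio ?T) \<le> ereal (c + 1 / real (Suc k))" for k
      using c elim(1) by (intro limsup_gap_ratio_le[where \<kappa> = "c + 1 / real (Suc k)"] add_pos_pos; simp)+
    have low: "ereal (c * (1 - 1 / real (Suc (Suc k)))) \<le> limsup (gap_ratio ?T)" for k
      using c elim(2) by (intro limsup_gap_ratio_ge[OF up(1) T]) auto
    have "limsup (gap_ratio ?T) \<le> ereal c"
    proof (rule tendsto_lowerbound)
      have "(\<lambda>k. c + 1 / real (Suc k)) \<longlonglongrightarrow> c" by real_asymp
      then show "(\<lambda>k. ereal (c + 1 / real (Suc k))) \<longlonglongrightarrow> ereal c" by simp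
    qed (use up in auto)
    moreover have "ereal c \<le> limsup (gap_ratio ?T)"
    proof (rule tendsto_upperbound)
      have "(\<lambda>k. c * (1 - 1 / real (Suc (Suc k)))) \<longlonglongrightarrow> c" by real_asymp
      then show "(\<lambda>k. ereal (c * (1 - 1 / real (Suc (Suc k))))) \<longlonglongrightarrow> ereal c" by simp
    qed (use low in auto)
    ultimately show ?case by (simp add: c_def)
  qed
qed

end

theorem theorem1:
  fixes M :: "'a measure" and A :: "'a \<Rightarrow> nat set" and s :: nat
  assumes "prob_space M"
    and "s \<ge> 2"
    and "\<And>\<omega>. 0 \<notin> A \<omega>"
    and "\<And>n. {\<omega> \<in> space M. n \<in> A \<omega>} \<in> sets M"
    and "prob_space.indep_events M (\<lambda>n. {\<omega> \<in> space M. n \<in> A \<omega>}) {1..}"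
    and "\<And>n. n \<ge> 1 \<Longrightarrow>
           measure M {\<omega> \<in> space M. n \<in> A \<omega>} = (1 / real s) * real n powr (-1 + 1 / real s)"
  shows "AE \<omega> in M.
           limsup (\<lambda>n. ereal ((real (enumerate (sumset s (A \<omega>)) (Suc n))
                               - real (enumerate (sumset s (A \<omega>)) n))
                              / ln (real (enumerate (sumset s (A \<omega>)) n))))
           = ereal (real s ^ s * fact s / Gamma (1 / real s) ^ s)"
proof -
  interpret prob_space M by (rule assms(1))
  interpret random_pseudo_powers M A s
    by unfold_locales (use assms in \<open>auto simp: elem_prob_def\<close>)
  show ?thesis using AE_limsup_gap_ratio by (simp add: limit_mean_def)
qed

end
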